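(* Let $X$ be a finite set, and let $\mathcal P_X$ be the partition monoid on $X$. Then $$\operatorname{Aut}(\mathcal P_X)\cong\operatorname{Sym}(X)\qquad\text{and}\qquad \mathscr C(\mathcal P_X)=\operatorname{Aut}^{\pm}(\mathcal P_X)\cong\mathbb Z_2\times\operatorname{Sym}(X).$$
   Context: Let $X'=\{x':x\in X\}$ and $X''=\{x'':x\in X\}$ be disjoint copies of $X$, disjoint from $X$. The partition monoid $\mathcal P_X$ consists of all set partitions of $X\cup X'$. The product $fg$ of $f,g\in\mathcal P_X$ is defined as follows: rename each $x'$ in $f$ as $x''$ to get a partition of $X\cup X''$, rename each $x$ in $g$ as $x''$ to get a partition of $X''\cup X'$, take the join of the two corresponding equivalence relations on $X\cup X''\cup X'$ (the smallest equivalence relation containing both), and restrict it to $X\cup X'$. $\operatorname{Sym}(X)$ is the group of all permutations of $X$. For a semigroup $S$: $\operatorname{Aut}(S)$ is the set of automorphisms of $S$; $\operatorname{Aut}^-(S)$ is the set of anti-automorphisms, i.e. bijections $\alpha:S\to S$ with $\alpha(xy)=\alpha(y)\alpha(x)$ for all $x,y\in S$; $\operatorname{Aut}^{\pm}(S)=\operatorname{Aut}(S)\cup\operatorname{Aut}^-(S)$, a group under composition. $I(S)=\{\alpha\in\operatorname{Aut}^-(S):\alpha^2=\mathrm{id}_S\neq\alpha\}$ is the set of involutions of $S$, and $\mathscr C(S)=\langle I(S)\rangle\le\operatorname{Aut}^{\pm}(S)$, interpreted as $\{\mathrm{id}_S\}$ if $I(S)=\emptyset$.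
   Formalization: The isomorphism of Aut^±(P_X) with Z_2 × Sym(X) is stated only for |X| ≥ 2, because for |X| ≤ 1 the group Aut^±(P_X) is trivial while Z_2 × Sym(X) has order 2; the other two claims are stated for every finite X. *)

theory Defs
  imports "HOL-Algebra.Bij" "HOL-Algebra.Generated_Groups" "HOL-Algebra.Elementary_Groups"
    "HOL-Library.Disjoint_Sets"
begin

section \<open>The partition monoid\<close>

text \<open>The three pairwise disjoint copies of the ground set: a point \<open>x\<close> itself, \<open>x'\<close> and \<open>x''\<close>.\<close>

datatype 'a vertex = Unprimed 'a | Primed 'a | DPrimed 'a

definition partitions :: "'a set \<Rightarrow> 'a vertex set set set" where
  "partitions X = {P. partition_on (Unprimed ` X \<union> Primed ` X) P}"

fun primed_to_dprimed :: "'a vertex \<Rightarrow> 'a vertex" where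
  "primed_to_dprimed (Unprimed x) = Unprimed x"
| "primed_to_dprimed (Primed x) = DPrimed x"
| "primed_to_dprimed (DPrimed x) = DPrimed x"

fun unprimed_to_dprimed :: "'a vertex \<Rightarrow> 'a vertex" where
  "unprimed_to_dprimed (Unprimed x) = DPrimed x"
| "unprimed_to_dprimed (Primed x) = Primed x"
| "unprimed_to_dprimed (DPrimed x) = DPrimed x"

definition rename :: "('b \<Rightarrow> 'c) \<Rightarrow> 'b set set \<Rightarrow> 'c set set" where
  "rename r P = (\<lambda>B. r ` B) ` P"

definition rel_of_partition :: "'b set set \<Rightarrow> 'b rel" where
  "rel_of_partition P = {(u, v). \<exists>B\<in>P. u \<in> B \<and> v \<in> B}"

text \<open>The smallest equivalence relation on \<open>A\<close> containing \<open>R\<close> and \<open>S\<close>; these may be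
  equivalence relations on subsets of \<open>A\<close> only.\<close>

definition equiv_join :: "'b set \<Rightarrow> 'b rel \<Rightarrow> 'b rel \<Rightarrow> 'b rel" where
  "equiv_join A R S = \<Inter>{E. equiv A E \<and> R \<subseteq> E \<and> S \<subseteq> E}"

definition partition_mult ::
  "'a set \<Rightarrow> 'a vertex set set \<Rightarrow> 'a vertex set set \<Rightarrow> 'a vertex set set" where
  "partition_mult X f g =
    (let E = equiv_join (Unprimed ` X \<union> DPrimed ` X \<union> Primed ` X)
               (rel_of_partition (rename primed_to_dprimed f))
               (rel_of_partition (rename unprimed_to_dprimed g));
         V = Unprimed ` X \<union> Primed ` X
     in V // (E \<inter> V \<times> V))"

definition partition_monoid :: "'a set \<Rightarrow> 'a vertex set set monoid" where
  "partition_monoid X =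
    \<lparr>carrier = partitions X,
     mult = partition_mult X,
     one = (\<lambda>x. {Unprimed x, Primed x}) ` X\<rparr>"

section \<open>Anti-automorphisms and involutions\<close>

text \<open>As for \<^const>\<open>auto\<close>, maps are extensional, i.e. \<^const>\<open>undefined\<close> outside the carrier, so that
  equality of maps is equality on the carrier. \<^const>\<open>hom\<close>, and hence \<^const>\<open>auto\<close>, only
  involves the multiplication, so all notions below are semigroup notions: the unit of the
  record is never used.\<close>

definition anti_auto :: "('a, 'b) monoid_scheme \<Rightarrow> ('a \<Rightarrow> 'a) set" where
  "anti_auto S = {\<alpha> \<in> Bij (carrier S).
     \<forall>x\<in>carrier S. \<forall>y\<in>carrier S. \<alpha> (x \<otimes>\<^bsub>S\<^esub> y) = \<alpha> y \<otimes>\<^bsub>S\<^esub> \<alpha> x}"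

definition AutoPMGroup :: "('a, 'b) monoid_scheme \<Rightarrow> ('a \<Rightarrow> 'a) monoid" where
  "AutoPMGroup S = BijGroup (carrier S) \<lparr>carrier := auto S \<union> anti_auto S\<rparr>"

definition involutions :: "('a, 'b) monoid_scheme \<Rightarrow> ('a \<Rightarrow> 'a) set" where
  "involutions S = {\<alpha> \<in> anti_auto S.
     compose (carrier S) \<alpha> \<alpha> = (\<lambda>x\<in>carrier S. x) \<and> \<alpha> \<noteq> (\<lambda>x\<in>carrier S. x)}"

text \<open>The subgroup generated by the involutions; it is \<open>{id}\<close> if there are none.\<close>

definition involution_subgroup :: "('a, 'b) monoid_scheme \<Rightarrow> ('a \<Rightarrow> 'a) set" where
  "involution_subgroup S = generate (AutoPMGroup S) (involutions S)"

end

(*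
  Left multiplication by an idempotent e detects the upper half of a partition f.  If e is the
  identity with x and x' cut apart (a "cut"), then e f = f iff {x} is a block of f; if e is the
  identity with the blocks of x and y merged (a "tie"), then e f = f iff x and y share a block
  of f.  Every idempotent other than 1 is fixed on the left by a cut or a tie.  A tie is fixed by
  a transposition, whereas g^2 = 1 and g e = e for a cut e imply g = 1; so an automorphism sends
  each cut to an idempotent fixed by a cut and not by a tie, and thereby induces a permutation
  of X.  Composed with the inverse relabelling, and by the dual argument on the right, it fixes
  all cuts, then all ties.  These determine a partition f: x and y' are linked in f iff cutting f
  at all points but x above and all points but y below does not leave only singletons.
  Anti-automorphisms are reduced to automorphisms by the flip, which exchanges x and x'.
*)
theory Submission
  imports Defs "HOL-Combinatorics.Permutations"
begin

text \<open>Equations such as \<open>e f = f\<close> pass to images under any multiplicative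
  bijection, which is why cuts and ties are tested by such equations. The obstacle is that the image
  of a cut is at the outset only some idempotent other than 1. Equations on the left pin it down
  only up to generating the same right ideal as a cut: the partition with blocks {x}, {z, z', x'}
  and the pairs {u, u'} for all other u is an idempotent generating the same right ideal as the cut
  at x. The lower half has to come from the dual argument. Links between x and y' escape the
  one-sided equations, each of which speaks about one half only. They are tested by an inequation
  instead: a two-sided product with larger cuts differs from the partition into singletons.
  Injectivity transports the inequation, and finiteness makes the larger cuts products of point
  cuts, hence fixed as well.\<close>

lemma equiv_equiv_join:
  assumes "R \<subseteq> A \<times> A" "S \<subseteq> A \<times> A"
  shows "equiv A (equiv_join A R S)"
proof -
  have *: "equiv A (A \<times> A)"
    by (auto simp: equiv_def refl_on_def sym_def trans_def)
  show ?thesis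
    unfolding equiv_join_def
  proof (rule equivI)
    show "\<Inter> {E. equiv A E \<and> R \<subseteq> E \<and> S \<subseteq> E} \<subseteq> A \<times> A"
      using * assms by (intro Inter_lower) auto
    show "refl_on A (\<Inter> {E. equiv A E \<and> R \<subseteq> E \<and> S \<subseteq> E})"
      by (auto simp: refl_on_def equiv_def)
    show "sym (\<Inter> {E. equiv A E \<and> R \<subseteq> E \<and> S \<subseteq> E})"
      by (auto simp: sym_def equiv_def)
    show "trans (\<Inter> {E. equiv A E \<and> R \<subseteq> E \<and> S \<subseteq> E})"
      unfolding equiv_def trans_def by blast
  qed
qed

lemma equiv_join_least:
  "equiv A E \<Longrightarrow> R \<subseteq> E \<Longrightarrow> S \<subseteq> E \<Longrightarrow> equiv_join A R S \<subseteq> E"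
  by (auto simp: equiv_join_def)

lemma equiv_join_upper: "R \<subseteq> equiv_join A R S" "S \<subseteq> equiv_join A R S"
  by (auto simp: equiv_join_def)

lemma equiv_restrict: "equiv A E \<Longrightarrow> B \<subseteq> A \<Longrightarrow> equiv B (E \<inter> B \<times> B)"
  unfolding equiv_def refl_on_def sym_def trans_def by blast

lemma equiv_kernel: "equiv A {(u, v). u \<in> A \<and> v \<in> A \<and> k u = k v}"
  by (auto simp: equiv_def refl_on_def sym_def trans_def)

lemma rel_of_quotient:
  assumes "equiv A E"
  shows "rel_of_partition (A // E) = E"
proof -
  have "(u, v) \<in> rel_of_partition (A // E) \<longleftrightarrow> (\<exists>x\<in>A. (x, u) \<in> E \<and> (x, v) \<in> E)" for u v
    by (auto simp: rel_of_partition_def quotient_def)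
  moreover have "(\<exists>x\<in>A. (x, u) \<in> E \<and> (x, v) \<in> E) \<longleftrightarrow> (u, v) \<in> E" for u v
  proof
    assume "\<exists>x\<in>A. (x, u) \<in> E \<and> (x, v) \<in> E"
    then show "(u, v) \<in> E"
      using assms unfolding equiv_def by (meson symD transD)
  next
    assume uv: "(u, v) \<in> E"
    then have "u \<in> A" using assms by (auto simp: equiv_def)
    then show "\<exists>x\<in>A. (x, u) \<in> E \<and> (x, v) \<in> E"
      using uv assms by (auto simp: equiv_def refl_on_def)
  qed
  ultimately show ?thesis by auto
qed

lemma rel_of_rename: "rel_of_partition (rename r f) = map_prod r r ` rel_of_partition f"
  by (auto simp: rel_of_partition_def rename_def image_iff)

abbreviation verts :: "'a set \<Rightarrow> 'a vertex set" where
  "verts X \<equiv> Unprimed ` X \<union> Primed ` X"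

abbreviation verts3 :: "'a set \<Rightarrow> 'a vertex set" where
  "verts3 X \<equiv> Unprimed ` X \<union> DPrimed ` X \<union> Primed ` X"

abbreviation linked :: "'b set set \<Rightarrow> 'b \<Rightarrow> 'b \<Rightarrow> bool" where
  "linked f u v \<equiv> (u, v) \<in> rel_of_partition f"

lemma primed_to_dprimed_in: "u \<in> verts X \<Longrightarrow> primed_to_dprimed u \<in> verts3 X"
  by auto

lemma unprimed_to_dprimed_in: "u \<in> verts X \<Longrightarrow> unprimed_to_dprimed u \<in> verts3 X"
  by auto

section \<open>Products and kernels of partitions\<close>

text \<open>The join on all three layers, before restriction: links of a product come from paths
  through the middle layer, so transitivity has to be applied here.\<close>

definition join3 :: "'a set \<Rightarrow> 'a vertex set set \<Rightarrow> 'a vertex set set \<Rightarrow> 'a vertex rel" where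
  "join3 X f g = equiv_join (verts3 X) (rel_of_partition (rename primed_to_dprimed f))
               (rel_of_partition (rename unprimed_to_dprimed g))"

text \<open>Concrete partitions are given by labelling the vertices, so that membership in
  \<open>partitions X\<close> and the description of the links come for free.\<close>

definition kernel_partition :: "'a set \<Rightarrow> ('a vertex \<Rightarrow> 'b) \<Rightarrow> 'a vertex set set" where
  "kernel_partition X k = verts X // {(u, v). u \<in> verts X \<and> v \<in> verts X \<and> k u = k v}"

lemma kernel_partition_in [simp]: "kernel_partition X k \<in> partitions X"
  using partition_on_quotient[OF equiv_kernel, of "verts X" k]
  by (simp only: kernel_partition_def partitions_def mem_Collect_eq)

lemma linked_kernel_partition [simp]:
  "linked (kernel_partition X k) u v \<longleftrightarrow> u \<in> verts X \<and> v \<in> verts X \<and> k u = k v"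
  by (simp only: kernel_partition_def rel_of_quotient[OF equiv_kernel]) simp

context
  fixes X :: "'a set"
begin

lemma equiv_rel_of_partition: "f \<in> partitions X \<Longrightarrow> equiv (verts X) (rel_of_partition f)"
  using equiv_partition_on[of "verts X" f] by (simp add: partitions_def rel_of_partition_def)

lemma quotient_rel_of_partition: "f \<in> partitions X \<Longrightarrow> verts X // rel_of_partition f = f"
  using partition_on_eq_quotient[of "verts X" f] by (simp add: partitions_def rel_of_partition_def)

lemma linked_in:
  assumes "f \<in> partitions X" "linked f u v"
  shows "u \<in> verts X" "v \<in> verts X"
  using equiv_rel_of_partition[OF assms(1)] assms(2) by (auto simp: equiv_def)

lemma linked_refl: "f \<in> partitions X \<Longrightarrow> u \<in> verts X \<Longrightarrow> linked f u u"
  using equiv_rel_of_partition[of f] by (auto simp: equiv_def refl_on_def)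

lemma linked_sym: "f \<in> partitions X \<Longrightarrow> linked f u v \<Longrightarrow> linked f v u"
  using equiv_rel_of_partition[of f] by (auto simp: equiv_def sym_def)

lemma linked_trans: "f \<in> partitions X \<Longrightarrow> linked f u v \<Longrightarrow> linked f v w \<Longrightarrow> linked f u w"
  using equiv_rel_of_partition[of f] unfolding equiv_def trans_def by blast

lemma partitions_eqI:
  assumes "f \<in> partitions X" "g \<in> partitions X"
    and "\<And>u v. u \<in> verts X \<Longrightarrow> v \<in> verts X \<Longrightarrow> linked f u v \<longleftrightarrow> linked g u v"
  shows "f = g"
proof -
  have "rel_of_partition f = rel_of_partition g"
  proof (intro subset_antisym subrelI)
    show "linked g u v" if "linked f u v" for u v
      using assms(3) linked_in[OF assms(1) that] that by blast
    show "linked f u v" if "linked g u v" for u v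
      using assms(3) linked_in[OF assms(2) that] that by blast
  qed
  then show ?thesis
    using quotient_rel_of_partition assms(1,2) by metis
qed

lemma equiv_join3:
  assumes "f \<in> partitions X" "g \<in> partitions X"
  shows "equiv (verts3 X) (join3 X f g)"
  unfolding join3_def rel_of_rename
proof (rule equiv_equiv_join)
  show "map_prod primed_to_dprimed primed_to_dprimed ` rel_of_partition f \<subseteq> verts3 X \<times> verts3 X"
    using linked_in[OF assms(1)] primed_to_dprimed_in[of _ X] by (clarsimp simp del: Un_iff)
  show "map_prod unprimed_to_dprimed unprimed_to_dprimed ` rel_of_partition g \<subseteq> verts3 X \<times> verts3 X"
    using linked_in[OF assms(2)] unprimed_to_dprimed_in[of _ X] by (clarsimp simp del: Un_iff)
qed

lemma join3_left: "linked f u v \<Longrightarrow> (primed_to_dprimed u, primed_to_dprimed v) \<in> join3 X f g"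
  unfolding join3_def rel_of_rename
  by (rule subsetD[OF equiv_join_upper(1)]) (auto simp: map_prod_def)

lemma join3_right: "linked g u v \<Longrightarrow> (unprimed_to_dprimed u, unprimed_to_dprimed v) \<in> join3 X f g"
  unfolding join3_def rel_of_rename
  by (rule subsetD[OF equiv_join_upper(2)]) (auto simp: map_prod_def)

lemma join3_least:
  assumes "equiv (verts3 X) E"
    and "\<And>u v. linked f u v \<Longrightarrow> (primed_to_dprimed u, primed_to_dprimed v) \<in> E"
    and "\<And>u v. linked g u v \<Longrightarrow> (unprimed_to_dprimed u, unprimed_to_dprimed v) \<in> E"
  shows "join3 X f g \<subseteq> E"
  unfolding join3_def rel_of_rename
  by (rule equiv_join_least) (use assms in auto)

lemma partition_mult_eq:
  "partition_mult X f g = verts X // (join3 X f g \<inter> verts X \<times> verts X)"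
  by (simp add: partition_mult_def join3_def Let_def)

lemma mult_in [simp]:
  assumes "f \<in> partitions X" "g \<in> partitions X"
  shows "partition_mult X f g \<in> partitions X"
  using equiv_restrict[OF equiv_join3[OF assms], of "verts X"]
  by (auto simp: partition_mult_eq partitions_def intro!: partition_on_quotient)

lemma linked_mult:
  assumes "f \<in> partitions X" "g \<in> partitions X"
  shows "linked (partition_mult X f g) u v \<longleftrightarrow>
    u \<in> verts X \<and> v \<in> verts X \<and> (u, v) \<in> join3 X f g"
proof -
  have "equiv (verts X) (join3 X f g \<inter> verts X \<times> verts X)"
    by (rule equiv_restrict[OF equiv_join3[OF assms]]) auto
  from rel_of_quotient[OF this] show ?thesis
    unfolding partition_mult_eq by auto
qed

lemma linked_multD:
  assumes "f \<in> partitions X" "g \<in> partitions X" "equiv (verts3 X) E"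
    and "\<And>u v. linked f u v \<Longrightarrow> (primed_to_dprimed u, primed_to_dprimed v) \<in> E"
    and "\<And>u v. linked g u v \<Longrightarrow> (unprimed_to_dprimed u, unprimed_to_dprimed v) \<in> E"
    and "linked (partition_mult X f g) u v"
  shows "(u, v) \<in> E"
  using assms linked_mult join3_least by blast

text \<open>The kernel of \<open>k\<close> is an equivalence relation containing both factors, hence
  their join. To separate two vertices in a product it suffices to find a labelling constant on the
  blocks of both factors; no alternating paths have to be analysed.\<close>

lemma linked_mult_kernelD:
  assumes "f \<in> partitions X" "g \<in> partitions X" "linked (partition_mult X f g) u v"
    and "\<And>u v. linked f u v \<Longrightarrow> k (primed_to_dprimed u) = k (primed_to_dprimed v)"
    and "\<And>u v. linked g u v \<Longrightarrow> k (unprimed_to_dprimed u) = k (unprimed_to_dprimed v)"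
  shows "k u = k v"
proof -
  have "(u, v) \<in> {(u, v). u \<in> verts3 X \<and> v \<in> verts3 X \<and> k u = k v}"
  proof (rule linked_multD[OF assms(1,2) equiv_kernel _ _ assms(3)])
    fix u v assume l: "linked f u v"
    show "(primed_to_dprimed u, primed_to_dprimed v)
        \<in> {(u, v). u \<in> verts3 X \<and> v \<in> verts3 X \<and> k u = k v}"
      using linked_in[OF assms(1) l] assms(4)[OF l] primed_to_dprimed_in[of _ X] by blast
  next
    fix u v assume l: "linked g u v"
    show "(unprimed_to_dprimed u, unprimed_to_dprimed v)
        \<in> {(u, v). u \<in> verts3 X \<and> v \<in> verts3 X \<and> k u = k v}"
      using linked_in[OF assms(2) l] assms(5)[OF l] unprimed_to_dprimed_in[of _ X] by blast
  qed
  then show ?thesis by simp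
qed

lemma linked_mult_upper:
  assumes "f \<in> partitions X" "g \<in> partitions X" "linked f (Unprimed x) (Unprimed y)"
  shows "linked (partition_mult X f g) (Unprimed x) (Unprimed y)"
  using join3_left[OF assms(3), of g] linked_in[OF assms(1,3)] by (simp add: linked_mult assms)

lemma linked_mult_through:
  assumes "f \<in> partitions X" "g \<in> partitions X"
    "linked f (Unprimed x) (Primed y)" "linked g (Unprimed y) (Primed z)"
  shows "linked (partition_mult X f g) (Unprimed x) (Primed z)"
proof -
  have "(Unprimed x, DPrimed y) \<in> join3 X f g" "(DPrimed y, Primed z) \<in> join3 X f g"
    using join3_left[OF assms(3), of g] join3_right[OF assms(4), of f] by auto
  then have "(Unprimed x, Primed z) \<in> join3 X f g"
    using equiv_join3[OF assms(1,2)] unfolding equiv_def trans_def by blast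
  then show ?thesis
    using linked_in[OF assms(1,3)] linked_in[OF assms(2,4)] by (simp add: linked_mult assms)
qed

definition upper_singleton :: "'a vertex set set \<Rightarrow> 'a \<Rightarrow> bool" where
  "upper_singleton f x \<longleftrightarrow> x \<in> X \<and> (\<forall>v. linked f (Unprimed x) v \<longrightarrow> v = Unprimed x)"

lemma upper_singleton_mult:
  assumes "f \<in> partitions X" "g \<in> partitions X" "upper_singleton f x"
  shows "upper_singleton (partition_mult X f g) x"
proof -
  have "v = Unprimed x" if "linked (partition_mult X f g) (Unprimed x) v" for v
  proof -
    \<comment> \<open>The labelling is the truth value of being \<open>Unprimed x\<close>. The right
      factor does not meet the upper layer, so it respects this labelling trivially.\<close>
    have "(Unprimed x = Unprimed x) = (v = Unprimed x)"
    proof (rule linked_mult_kernelD[OF assms(1,2) that])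
      fix u v assume l: "linked f u v"
      have "u = Unprimed x \<longleftrightarrow> v = Unprimed x"
        using l linked_sym[OF assms(1) l] assms(3) by (auto simp: upper_singleton_def)
      moreover have "primed_to_dprimed w = Unprimed x \<longleftrightarrow> w = Unprimed x" for w
        by (cases w) auto
      ultimately show "(primed_to_dprimed u = Unprimed x) = (primed_to_dprimed v = Unprimed x)"
        by simp
    next
      have "unprimed_to_dprimed w \<noteq> Unprimed x" for w
        by (cases w) auto
      then show "(unprimed_to_dprimed u = Unprimed x) = (unprimed_to_dprimed v = Unprimed x)" for u v
        by simp
    qed
    then show ?thesis by simp
  qed
  then show ?thesis
    using assms(3) by (simp add: upper_singleton_def)
qed

lemma join3_equivD:
  assumes "f \<in> partitions X" "g \<in> partitions X"
  shows "u \<in> verts3 X \<Longrightarrow> (u, u) \<in> join3 X f g"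
    and "(u, v) \<in> join3 X f g \<Longrightarrow> (v, u) \<in> join3 X f g"
    and "(u, v) \<in> join3 X f g \<Longrightarrow> (v, w) \<in> join3 X f g \<Longrightarrow> (u, w) \<in> join3 X f g"
  using equiv_join3[OF assms] unfolding equiv_def refl_on_def sym_def trans_def by blast+

end

section \<open>Cuts, ties and transpositions\<close>

fun base :: "'a vertex \<Rightarrow> 'a" where
  "base (Unprimed a) = a"
| "base (Primed a) = a"
| "base (DPrimed a) = a"

fun map_unprimed :: "('a \<Rightarrow> 'a) \<Rightarrow> 'a vertex \<Rightarrow> 'a vertex" where
  "map_unprimed s (Unprimed a) = Unprimed (s a)"
| "map_unprimed s (Primed a) = Primed a"
| "map_unprimed s (DPrimed a) = DPrimed a"

text \<open>Made for a left factor that links the upper \<open>a\<close> to the lower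
  \<open>s a\<close>: both are represented by the upper vertex \<open>s a\<close> of the right
  factor, to which they get attached.\<close>

fun unprime_or_map :: "('a \<Rightarrow> 'a) \<Rightarrow> 'a vertex \<Rightarrow> 'a vertex" where
  "unprime_or_map s (Unprimed a) = Unprimed (s a)"
| "unprime_or_map s (Primed a) = Unprimed a"
| "unprime_or_map s (DPrimed a) = DPrimed a"

text \<open>\<open>A\<close> is a set so that one construction yields the identity (\<open>A\<close>
  empty), the idempotents isolating a single point, and the partition into singletons
  (\<open>A = X\<close>).\<close>

definition cut :: "'a set \<Rightarrow> 'a set \<Rightarrow> 'a vertex set set" where
  "cut X A = kernel_partition X (\<lambda>u. if base u \<in> A then u else Unprimed (base u))"

definition tie :: "'a set \<Rightarrow> 'a \<Rightarrow> 'a \<Rightarrow> 'a vertex set set" where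
  "tie X x y = kernel_partition X (\<lambda>u. if base u = y then x else base u)"

definition swap :: "'a set \<Rightarrow> 'a \<Rightarrow> 'a \<Rightarrow> 'a vertex set set" where
  "swap X x y = kernel_partition X (\<lambda>u. base (map_unprimed (transpose x y) u))"

definition block_of :: "'b set set \<Rightarrow> 'b \<Rightarrow> 'b set" where
  "block_of f u = {v. linked f u v}"

context
  fixes X :: "'a set"
begin

lemma cut_in [simp]: "cut X A \<in> partitions X"
  and tie_in [simp]: "tie X x y \<in> partitions X"
  and swap_in [simp]: "swap X x y \<in> partitions X"
  by (simp_all add: cut_def tie_def swap_def)

lemma linked_cut:
  "linked (cut X A) u v \<longleftrightarrow> u \<in> verts X \<and> v \<in> verts X \<and> (u = v \<or> base u = base v \<and> base u \<notin> A)"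
  by (auto simp: cut_def)

lemma linked_tie:
  "linked (tie X x y) u v \<longleftrightarrow> u \<in> verts X \<and> v \<in> verts X \<and>
    (base u = base v \<or> base u \<in> {x, y} \<and> base v \<in> {x, y})"
  by (auto simp: tie_def)

lemma linked_swap:
  "linked (swap X x y) u v \<longleftrightarrow> u \<in> verts X \<and> v \<in> verts X \<and>
    base (map_unprimed (transpose x y) u) = base (map_unprimed (transpose x y) v)"
  by (auto simp: swap_def)

lemma upper_singleton_cut [simp]: "upper_singleton X (cut X A) x \<longleftrightarrow> x \<in> X \<and> x \<in> A"
  unfolding upper_singleton_def linked_cut by auto

lemma not_upper_singleton_tie [simp]: "\<not> upper_singleton X (tie X x y) z"
  unfolding upper_singleton_def linked_tie by (auto intro!: exI[of _ "Primed z"])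

lemma block_of_eq_iff:
  assumes "f \<in> partitions X" "u \<in> verts X" "v \<in> verts X"
  shows "block_of f u = block_of f v \<longleftrightarrow> linked f u v"
proof -
  have "linked f u u" "linked f v v"
    using linked_refl assms by blast+
  then show ?thesis
    unfolding block_of_def using linked_sym[OF assms(1)] linked_trans[OF assms(1)] by blast
qed

lemma block_of_cong:
  assumes "f \<in> partitions X" "linked f u v"
  shows "block_of f u = block_of f v"
  using block_of_eq_iff[OF assms(1) linked_in[OF assms]] assms(2) by simp

text \<open>The left factor only redirects: it attaches \<open>a\<close> to the point
  \<open>s a\<close> of \<open>f\<close>, and it merges no blocks of \<open>f\<close>, because its
  links, transported to \<open>f\<close>, already hold there. Ties use this with the identity map,
  swaps with a transposition.\<close>

lemma linked_mult_left:
  assumes f: "f \<in> partitions X" and g: "g \<in> partitions X"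
    and s: "\<And>a. a \<in> X \<Longrightarrow> linked g (Unprimed a) (Primed (s a))"
    and link: "\<And>u v. linked g u v \<Longrightarrow> linked f (unprime_or_map s u) (unprime_or_map s v)"
    and uv: "u \<in> verts X" "v \<in> verts X"
  shows "linked (partition_mult X g f) u v \<longleftrightarrow> linked f (map_unprimed s u) (map_unprimed s v)"
proof
  assume l: "linked (partition_mult X g f) u v"
  \<comment> \<open>\<open>?q\<close> sends a vertex of the three layers to the vertex of
    \<open>f\<close> to which it is attached; the middle copy of \<open>a\<close> is the upper
    \<open>a\<close> of \<open>f\<close>.\<close>
  let ?q = "\<lambda>w. case w of Unprimed a \<Rightarrow> Unprimed (s a) | DPrimed a \<Rightarrow> Unprimed a | Primed a \<Rightarrow> Primed a"
  have "block_of f (?q u) = block_of f (?q v)"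
  proof (rule linked_mult_kernelD[OF g f l])
    fix u v assume l: "linked g u v"
    have "?q (primed_to_dprimed w) = unprime_or_map s w" if "w \<in> verts X" for w
      using that by auto
    then show "block_of f (?q (primed_to_dprimed u)) = block_of f (?q (primed_to_dprimed v))"
      using block_of_cong[OF f link[OF l]] linked_in[OF g l] by simp
  next
    fix u v assume l: "linked f u v"
    have "?q (unprimed_to_dprimed w) = w" if "w \<in> verts X" for w
      using that by auto
    then show "block_of f (?q (unprimed_to_dprimed u)) = block_of f (?q (unprimed_to_dprimed v))"
      using block_of_cong[OF f l] linked_in[OF f l] by simp
  qed
  moreover have sX: "s a \<in> X" if "a \<in> X" for a
    using linked_in(2)[OF g s[OF that]] by auto
  moreover have "?q w = map_unprimed s w" "?q w \<in> verts X" if "w \<in> verts X" for w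
    using that sX by auto
  ultimately show "linked f (map_unprimed s u) (map_unprimed s v)"
    using block_of_eq_iff[OF f] uv by metis
next
  assume l: "linked f (map_unprimed s u) (map_unprimed s v)"
  note J = join3_equivD[OF g f]
  \<comment> \<open>Each vertex of the product is joined to its representative in the copy of
    \<open>f\<close>, so a link of \<open>f\<close> can be extended at both ends.\<close>
  have c: "(w, unprimed_to_dprimed (map_unprimed s w)) \<in> join3 X g f" if "w \<in> verts X" for w
    using that join3_left[OF s, where X = X and g = f] J(1) by auto
  have "(u, v) \<in> join3 X g f"
    by (rule J(3)[OF c[OF uv(1)] J(3)[OF join3_right[OF l] J(2)[OF c[OF uv(2)]]]])
  then show "linked (partition_mult X g f) u v"
    using uv by (simp add: linked_mult f g)
qed

text \<open>The upper link of the tie survives in the product. Conversely, if \<open>f\<close> has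
  this link, the tie merges nothing new.\<close>

lemma tie_mult_iff:
  assumes f: "f \<in> partitions X" and "x \<in> X" "y \<in> X"
  shows "partition_mult X (tie X x y) f = f \<longleftrightarrow> linked f (Unprimed x) (Unprimed y)"
proof
  assume "partition_mult X (tie X x y) f = f"
  moreover have "linked (tie X x y) (Unprimed x) (Unprimed y)"
    using assms by (simp add: linked_tie)
  ultimately show "linked f (Unprimed x) (Unprimed y)"
    using linked_mult_upper[OF tie_in f] by metis
next
  assume l: "linked f (Unprimed x) (Unprimed y)"
  note l' = linked_sym[OF f l]
  show "partition_mult X (tie X x y) f = f"
  proof (rule partitions_eqI[where X = X])
    fix u v assume uv: "u \<in> verts X" "v \<in> verts X"
    have "linked (partition_mult X (tie X x y) f) u v \<longleftrightarrow>
      linked f (map_unprimed (\<lambda>a. a) u) (map_unprimed (\<lambda>a. a) v)"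
    proof (rule linked_mult_left[OF f tie_in _ _ uv])
      fix u v assume "linked (tie X x y) u v"
      then show "linked f (unprime_or_map (\<lambda>a. a) u) (unprime_or_map (\<lambda>a. a) v)"
        using l l' linked_refl[OF f] assms(2,3) by (auto simp: linked_tie)
    qed (simp add: linked_tie)
    also have "map_unprimed (\<lambda>a. a) = (\<lambda>w :: 'a vertex. w)"
      by (rule ext, case_tac w) simp_all
    finally show "linked (partition_mult X (tie X x y) f) u v \<longleftrightarrow> linked f u v" .
  qed (use f in simp_all)
qed

lemma linked_swap_mult:
  assumes f: "f \<in> partitions X" and xy: "x \<in> X" "y \<in> X"
    and uv: "u \<in> verts X" "v \<in> verts X"
  shows "linked (partition_mult X (swap X x y) f) u v \<longleftrightarrow>
    linked f (map_unprimed (transpose x y) u) (map_unprimed (transpose x y) v)"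
proof (rule linked_mult_left[OF f swap_in _ _ uv])
  have tr: "transpose x y a \<in> X" if "a \<in> X" for a
    using that xy by (auto simp: transpose_def)
  fix a assume "a \<in> X"
  then show "linked (swap X x y) (Unprimed a) (Primed (transpose x y a))"
    using tr by (simp add: linked_swap)
next
  fix u v assume l: "linked (swap X x y) u v"
  have tr: "transpose x y a \<in> X" if "a \<in> X" for a
    using that xy by (auto simp: transpose_def)
  have "unprime_or_map (transpose x y) w = Unprimed (base (map_unprimed (transpose x y) w))"
    "unprime_or_map (transpose x y) w \<in> verts X"
    if "w \<in> verts X" for w
    using that tr by auto
  then show "linked f (unprime_or_map (transpose x y) u) (unprime_or_map (transpose x y) v)"
    using l linked_refl[OF f] by (metis linked_swap)
qed

lemma linked_cut_mult:
  assumes f: "f \<in> partitions X"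
  shows "linked (partition_mult X (cut X A) f) u v \<longleftrightarrow> u \<in> verts X \<and> v \<in> verts X \<and>
    (u = v \<or> linked f u v \<and> u \<notin> Unprimed ` A \<and> v \<notin> Unprimed ` A)"
proof (intro iffI conjI)
  assume l: "linked (partition_mult X (cut X A) f) u v"
  show uv: "u \<in> verts X" "v \<in> verts X"
    using linked_in[OF _ l] f by simp_all
  \<comment> \<open>The sum type keeps the isolated upper points (\<open>Inl\<close>) apart from the
    blocks of \<open>f\<close> (\<open>Inr\<close>), which label all other vertices, including the
    whole middle layer.\<close>
  let ?q = "\<lambda>w. if w \<in> Unprimed ` A then Inl w else
    Inr (block_of f (case w of Unprimed a \<Rightarrow> Unprimed a | DPrimed a \<Rightarrow> Unprimed a | Primed a \<Rightarrow> Primed a))"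
  have "?q u = ?q v"
  proof (rule linked_mult_kernelD[OF cut_in f l])
    fix u v assume "linked (cut X A) u v"
    then show "?q (primed_to_dprimed u) = ?q (primed_to_dprimed v)"
      by (auto simp: linked_cut)
  next
    fix u v assume l: "linked f u v"
    have "?q (unprimed_to_dprimed w) = Inr (block_of f w)" if "w \<in> verts X" for w
      using that by auto
    then show "?q (unprimed_to_dprimed u) = ?q (unprimed_to_dprimed v)"
      using block_of_cong[OF f l] linked_in[OF f l] by simp
  qed
  moreover have "?q w = (if w \<in> Unprimed ` A then Inl w else Inr (block_of f w))"
    if "w \<in> verts X" for w
    using that by auto
  ultimately have "(if u \<in> Unprimed ` A then Inl u else Inr (block_of f u)) =
    (if v \<in> Unprimed ` A then Inl v else Inr (block_of f v))"
    using uv by metis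
  then show "u = v \<or> linked f u v \<and> u \<notin> Unprimed ` A \<and> v \<notin> Unprimed ` A"
    using block_of_eq_iff[OF f uv] by (auto split: if_splits)
next
  assume *: "u \<in> verts X \<and> v \<in> verts X \<and>
    (u = v \<or> linked f u v \<and> u \<notin> Unprimed ` A \<and> v \<notin> Unprimed ` A)"
  show "linked (partition_mult X (cut X A) f) u v"
  proof (cases "u = v")
    case True
    then show ?thesis using * linked_refl[OF mult_in[OF cut_in f]] by blast
  next
    case False
    note J = join3_equivD[OF cut_in f]
    have c: "(w, unprimed_to_dprimed w) \<in> join3 X (cut X A) f" if "w \<in> verts X" "w \<notin> Unprimed ` A" for w
    proof -
      have "(Unprimed a, DPrimed a) \<in> join3 X (cut X A) f" if "a \<in> X" "Unprimed a \<notin> Unprimed ` A" for a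
        using that join3_left[where f = "cut X A" and u = "Unprimed a" and v = "Primed a" and X = X and g = f] by (auto simp: linked_cut)
      then show ?thesis
        using that J(1) by auto
    qed
    from * False have l: "linked f u v" and uv: "u \<in> verts X" "v \<in> verts X"
      and nA: "u \<notin> Unprimed ` A" "v \<notin> Unprimed ` A" by auto
    have "(u, v) \<in> join3 X (cut X A) f"
      by (rule J(3)[OF c[OF uv(1) nA(1)] J(3)[OF join3_right[OF l] J(2)[OF c[OF uv(2) nA(2)]]]])
    then show ?thesis
      using * by (simp add: linked_mult f)
  qed
qed

end

section \<open>Flipping and relabelling\<close>

fun flip_vertex :: "'a vertex \<Rightarrow> 'a vertex" where
  "flip_vertex (Unprimed a) = Primed a"
| "flip_vertex (Primed a) = Unprimed a"
| "flip_vertex (DPrimed a) = DPrimed a"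

abbreviation flip :: "'a vertex set set \<Rightarrow> 'a vertex set set" where
  "flip \<equiv> rename flip_vertex"

abbreviation relabel :: "('a \<Rightarrow> 'a) \<Rightarrow> 'a vertex set set \<Rightarrow> 'a vertex set set" where
  "relabel s \<equiv> rename (map_vertex s)"

lemma flip_vertex_invol [simp]: "flip_vertex (flip_vertex u) = u"
  by (cases u) auto

lemma map_vertex_flip_vertex: "map_vertex s (flip_vertex u) = flip_vertex (map_vertex s u)"
  by (cases u) auto

lemma rename_rename: "rename r (rename s f) = rename (r \<circ> s) f"
  by (simp add: rename_def image_image)

lemma flip_flip [simp]: "flip (flip f) = f"
  by (simp add: rename_def image_image)

lemma relabel_flip: "relabel s (flip f) = flip (relabel s f)"
  by (simp add: rename_rename comp_def map_vertex_flip_vertex)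

lemma linked_flip: "linked (flip f) u v \<longleftrightarrow> linked f (flip_vertex u) (flip_vertex v)"
  by (auto simp: rel_of_rename image_iff intro!: bexI[of _ "(flip_vertex u, flip_vertex v)"])

lemma linked_rename: "linked f u v \<Longrightarrow> linked (rename r f) (r u) (r v)"
  by (auto simp: rel_of_rename)

context
  fixes X :: "'a set"
begin

lemma rename_in:
  assumes "f \<in> partitions X" "bij_betw r (verts X) (verts X)"
  shows "rename r f \<in> partitions X"
proof -
  have "partition_on (r ` verts X) ((`) r ` f - {{}})"
    using assms partition_on_inj_image[of "verts X" f r] by (simp add: partitions_def bij_betw_def)
  moreover have "{} \<notin> (`) r ` f"
    using assms(1) by (auto simp: partitions_def partition_on_def)
  ultimately show ?thesis
    using assms(2) by (simp add: partitions_def rename_def bij_betw_def)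
qed

lemma flip_in [simp]: "f \<in> partitions X \<Longrightarrow> flip f \<in> partitions X"
  by (erule rename_in) (rule bij_betw_byWitness[where f' = flip_vertex], auto)

lemma flip_mult:
  assumes f: "f \<in> partitions X" and g: "g \<in> partitions X"
  shows "flip (partition_mult X f g) = partition_mult X (flip g) (flip f)"
proof -
  \<comment> \<open>One implication for all \<open>f\<close> and \<open>g\<close> suffices: the
    converse is its instance at the flipped factors, since the flip is its own inverse.\<close>
  have *: "linked (partition_mult X (flip g) (flip f)) (flip_vertex u) (flip_vertex v)"
    if f: "f \<in> partitions X" and g: "g \<in> partitions X" and l: "linked (partition_mult X f g) u v"
    for f g u v
  proof -
    let ?J = "join3 X (flip g) (flip f)"
    note J = join3_equivD[OF flip_in[OF g] flip_in[OF f]]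
    \<comment> \<open>The pullback of the join along the flip is an equivalence relation containing
      both factors, so the leastness of the join applies.\<close>
    let ?E = "{(u, v). u \<in> verts3 X \<and> v \<in> verts3 X \<and> (flip_vertex u, flip_vertex v) \<in> ?J}"
    have fl: "flip_vertex w \<in> verts3 X" if "w \<in> verts3 X" for w
      using that by auto
    have "equiv (verts3 X) ?E"
    proof (rule equivI)
      show "refl_on (verts3 X) ?E"
        using J(1) fl by (auto simp: refl_on_def)
      show "sym ?E" using J(2) by (auto simp: sym_def)
      show "trans ?E" using J(3) unfolding trans_def by blast
    qed auto
    then have "(u, v) \<in> ?E"
    proof (rule linked_multD[OF f g _ _ _ l])
      fix u v assume l: "linked f u v"
      then have "linked (flip f) (flip_vertex u) (flip_vertex v)"
        by (simp add: linked_flip)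
      from join3_right[where X = X and f = "flip g", OF this]
      have "(unprimed_to_dprimed (flip_vertex u), unprimed_to_dprimed (flip_vertex v)) \<in> ?J" .
      moreover have "unprimed_to_dprimed (flip_vertex w) = flip_vertex (primed_to_dprimed w)" for w :: "'a vertex"
        by (cases w) auto
      ultimately show "(primed_to_dprimed u, primed_to_dprimed v) \<in> ?E"
        using linked_in[OF f l] primed_to_dprimed_in[of _ X] by simp
    next
      fix u v assume l: "linked g u v"
      then have "linked (flip g) (flip_vertex u) (flip_vertex v)"
        by (simp add: linked_flip)
      from join3_left[where X = X and g = "flip f", OF this]
      have "(primed_to_dprimed (flip_vertex u), primed_to_dprimed (flip_vertex v)) \<in> ?J" .
      moreover have "primed_to_dprimed (flip_vertex w) = flip_vertex (unprimed_to_dprimed w)" for w :: "'a vertex"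
        by (cases w) auto
      ultimately show "(unprimed_to_dprimed u, unprimed_to_dprimed v) \<in> ?E"
        using linked_in[OF g l] unprimed_to_dprimed_in[of _ X] by simp
    qed
    then show ?thesis
      using linked_in[OF mult_in[OF f g] l]
      by (auto simp: linked_mult[OF flip_in[OF g] flip_in[OF f]])
  qed
  show ?thesis
  proof (rule partitions_eqI[where X = X])
    fix u v
    show "linked (flip (partition_mult X f g)) u v \<longleftrightarrow> linked (partition_mult X (flip g) (flip f)) u v"
      using *[OF f g, of "flip_vertex u" "flip_vertex v"] *[OF flip_in[OF g] flip_in[OF f], of u v]
      by (auto simp: linked_flip)
  qed (use f g in simp_all)
qed

lemma flip_cut [simp]: "flip (cut X A) = cut X A"
  and flip_tie [simp]: "flip (tie X x y) = tie X x y"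
proof -
  have *: "base (flip_vertex u) = base u" "flip_vertex u \<in> verts X \<longleftrightarrow> u \<in> verts X"
    "flip_vertex u = flip_vertex v \<longleftrightarrow> u = v" for u v :: "'a vertex"
    by (cases u; cases v; auto)+
  show "flip (cut X A) = cut X A" "flip (tie X x y) = tie X x y"
    by (rule partitions_eqI[where X = X]; simp add: linked_flip linked_cut linked_tie * del: Un_iff)+
qed

lemma map_vertex_Bij:
  assumes "bij_betw s X X"
  shows "bij_betw (map_vertex s) (verts X) (verts X)"
proof (rule bij_betw_byWitness[where f' = "map_vertex (inv_into X s)"])
  show "\<forall>a\<in>verts X. map_vertex (inv_into X s) (map_vertex s a) = a"
    using assms by (auto simp: bij_betw_def)
  show "\<forall>a'\<in>verts X. map_vertex s (map_vertex (inv_into X s) a') = a'"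
    using assms by (auto simp: bij_betw_def f_inv_into_f)
  show "map_vertex s ` verts X \<subseteq> verts X"
    using bij_betw_apply[OF assms] by auto
  show "map_vertex (inv_into X s) ` verts X \<subseteq> verts X"
    using assms inv_into_into[of _ s X] by (auto simp: bij_betw_def)
qed

lemma relabel_in [simp]: "f \<in> partitions X \<Longrightarrow> bij_betw s X X \<Longrightarrow> relabel s f \<in> partitions X"
  by (simp add: rename_in map_vertex_Bij)

lemma relabel_cong:
  assumes f: "f \<in> partitions X" and st: "\<And>x. x \<in> X \<Longrightarrow> s x = t x"
  shows "relabel s f = relabel t f"
  unfolding rename_def
proof (intro image_cong refl)
  fix B w assume "B \<in> f" "w \<in> B"
  moreover have "partition_on (verts X) f"
    using f by (simp add: partitions_def)
  ultimately have "w \<in> verts X"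
    by (metis UnionI partition_onD1)
  then show "map_vertex s w = map_vertex t w"
    using st by auto
qed

lemma relabel_id:
  assumes "f \<in> partitions X" "\<And>x. x \<in> X \<Longrightarrow> s x = x"
  shows "relabel s f = f"
  using relabel_cong[OF assms(1), of s id] assms(2) by (simp add: rename_def vertex.map_id0)

lemma relabel_relabel: "relabel s (relabel t f) = relabel (s \<circ> t) f"
  by (simp add: rename_rename vertex.map_comp comp_def)

lemma relabel_inv:
  assumes "f \<in> partitions X" "bij_betw s X X"
  shows "relabel (inv_into X s) (relabel s f) = f" "relabel s (relabel (inv_into X s) f) = f"
  using assms by (auto simp: relabel_relabel bij_betw_def f_inv_into_f intro!: relabel_id)

text \<open>The pullback argument used for the flip, now along the relabelling of all three layers.
  The converse comes from the inverse permutation.\<close>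

lemma relabel_linked_mult:
  assumes s: "bij_betw s X X" and f: "f \<in> partitions X" and g: "g \<in> partitions X"
    and l: "linked (partition_mult X f g) u v"
  shows "linked (partition_mult X (relabel s f) (relabel s g)) (map_vertex s u) (map_vertex s v)"
proof -
  let ?J = "join3 X (relabel s f) (relabel s g)"
  have in_P: "relabel s f \<in> partitions X" "relabel s g \<in> partitions X"
    using assms by auto
  note J = join3_equivD[OF in_P]
  let ?E = "{(u, v). u \<in> verts3 X \<and> v \<in> verts3 X \<and> (map_vertex s u, map_vertex s v) \<in> ?J}"
  have fl: "map_vertex s w \<in> verts3 X" if "w \<in> verts3 X" for w
    using that bij_betw_apply[OF s] by auto
  have "equiv (verts3 X) ?E"
  proof (rule equivI)
    show "refl_on (verts3 X) ?E"
      using J(1) fl by (auto simp: refl_on_def)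
    show "sym ?E" using J(2) by (auto simp: sym_def)
    show "trans ?E" using J(3) unfolding trans_def by blast
  qed auto
  then have "(u, v) \<in> ?E"
  proof (rule linked_multD[OF f g _ _ _ l])
    fix u v assume l: "linked f u v"
    have "primed_to_dprimed (map_vertex s w) = map_vertex s (primed_to_dprimed w)" for w
      by (cases w) auto
    then show "(primed_to_dprimed u, primed_to_dprimed v) \<in> ?E"
      using linked_in[OF f l] primed_to_dprimed_in[of _ X]
        join3_left[where X = X and g = "relabel s g", OF linked_rename[OF l, of "map_vertex s"]] by simp
  next
    fix u v assume l: "linked g u v"
    have "unprimed_to_dprimed (map_vertex s w) = map_vertex s (unprimed_to_dprimed w)" for w
      by (cases w) auto
    then show "(unprimed_to_dprimed u, unprimed_to_dprimed v) \<in> ?E"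
      using linked_in[OF g l] unprimed_to_dprimed_in[of _ X]
        join3_right[where X = X and f = "relabel s f", OF linked_rename[OF l, of "map_vertex s"]] by simp
  qed
  moreover have "map_vertex s u \<in> verts X" "map_vertex s v \<in> verts X"
    using linked_in[OF mult_in[OF f g] l] bij_betw_apply[OF map_vertex_Bij[OF s]] by metis+
  ultimately show ?thesis
    by (simp add: linked_mult[OF in_P])
qed

lemma relabel_mult:
  assumes s: "bij_betw s X X" and f: "f \<in> partitions X" and g: "g \<in> partitions X"
  shows "relabel s (partition_mult X f g) = partition_mult X (relabel s f) (relabel s g)"
proof (rule partitions_eqI[where X = X])
  fix u v
  let ?t = "inv_into X s"
  assume uv: "u \<in> verts X" "v \<in> verts X"
  have t: "bij_betw ?t X X" by (rule bij_betw_inv_into[OF s])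
  have st: "map_vertex s (map_vertex ?t w) = w" if "w \<in> verts X" for w
    using that s by (auto simp: bij_betw_def f_inv_into_f)
  show "linked (relabel s (partition_mult X f g)) u v \<longleftrightarrow>
    linked (partition_mult X (relabel s f) (relabel s g)) u v"
  proof
    assume "linked (relabel s (partition_mult X f g)) u v"
    then obtain u' v' where "linked (partition_mult X f g) u' v'" "u = map_vertex s u'" "v = map_vertex s v'"
      by (auto simp: rel_of_rename)
    then show "linked (partition_mult X (relabel s f) (relabel s g)) u v"
      using relabel_linked_mult[OF s f g] by blast
  next
    assume "linked (partition_mult X (relabel s f) (relabel s g)) u v"
    from relabel_linked_mult[OF t _ _ this]
    have "linked (partition_mult X f g) (map_vertex ?t u) (map_vertex ?t v)"
      using f g s by (simp add: relabel_inv)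
    from linked_rename[OF this, of "map_vertex s"]
    show "linked (relabel s (partition_mult X f g)) u v"
      using st uv by (simp del: Un_iff)
  qed
qed (use assms in simp_all)

lemma linked_relabel:
  assumes s: "bij_betw s X X" and f: "f \<in> partitions X" and u: "u \<in> verts X" and v: "v \<in> verts X"
  shows "linked (relabel s f) (map_vertex s u) (map_vertex s v) \<longleftrightarrow> linked f u v"
proof
  assume "linked (relabel s f) (map_vertex s u) (map_vertex s v)"
  then obtain u' v' where *: "linked f u' v'" "map_vertex s u = map_vertex s u'" "map_vertex s v = map_vertex s v'"
    by (auto simp: rel_of_rename)
  have "inj_on (map_vertex s) (verts X)"
    using map_vertex_Bij[OF s] by (simp add: bij_betw_def)
  then have "u = u'" "v = v'"
    using * u v linked_in[OF f *(1)] by (metis inj_onD)+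
  then show "linked f u v" using * by simp
qed (rule linked_rename)

lemma relabel_cut:
  assumes s: "bij_betw s X X" and "x \<in> X"
  shows "relabel s (cut X {x}) = cut X {s x}"
proof (rule partitions_eqI[where X = X])
  fix u v
  assume uv: "u \<in> verts X" "v \<in> verts X"
  let ?m = "map_vertex s"
  have "?m ` verts X = verts X"
    using map_vertex_Bij[OF s] by (simp add: bij_betw_def)
  then have "u \<in> ?m ` verts X" "v \<in> ?m ` verts X"
    by (simp_all only: uv)
  then obtain u' v' where u': "u' \<in> verts X" "u = ?m u'" and v': "v' \<in> verts X" "v = ?m v'"
    by (elim imageE)
  have inj: "inj_on ?m (verts X)" using map_vertex_Bij[OF s] by (simp add: bij_betw_def)
  have b: "base (?m w) = s (base w)" "base w \<in> X" if "w \<in> verts X" for w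
    using that by auto
  have sinj: "s a = s b \<longleftrightarrow> a = b" if "a \<in> X" "b \<in> X" for a b
    using that s by (auto simp: bij_betw_def inj_on_def)
  have "linked (relabel s (cut X {x})) u v \<longleftrightarrow> linked (cut X {x}) u' v'"
    by (simp only: u'(2) v'(2) linked_relabel[OF s cut_in u'(1) v'(1)])
  also have "\<dots> \<longleftrightarrow> linked (cut X {s x}) u v"
    using u' v' inj_on_eq_iff[OF inj] uv b sinj assms(2) by (simp add: linked_cut del: Un_iff)
  finally show "linked (relabel s (cut X {x})) u v \<longleftrightarrow> linked (cut X {s x}) u v" .
qed (use s in simp_all)

end

section \<open>Automorphisms are relabellings\<close>

text \<open>An automorphism without the requirement of being \<open>undefined\<close> off the
  carrier, so that plain composition with \<open>relabel\<close> and \<open>flip\<close> stays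
  within the notion.\<close>

definition mult_bij :: "'a set \<Rightarrow> ('a vertex set set \<Rightarrow> 'a vertex set set) \<Rightarrow> bool" where
  "mult_bij X \<alpha> \<longleftrightarrow> bij_betw \<alpha> (partitions X) (partitions X) \<and>
    (\<forall>f\<in>partitions X. \<forall>g\<in>partitions X. \<alpha> (partition_mult X f g) = partition_mult X (\<alpha> f) (\<alpha> g))"

context
  fixes X :: "'a set"
begin

abbreviation mul (infixl "\<bullet>" 70) where "f \<bullet> g \<equiv> partition_mult X f g"
abbreviation "unity \<equiv> cut X {}"

lemma linked_mult_cut:
  assumes f: "f \<in> partitions X"
  shows "linked (f \<bullet> cut X A) u v \<longleftrightarrow> u \<in> verts X \<and> v \<in> verts X \<and>
    (u = v \<or> linked f u v \<and> u \<notin> Primed ` A \<and> v \<notin> Primed ` A)"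
proof -
  have "f \<bullet> cut X A = flip (cut X A \<bullet> flip f)"
    using f by (simp add: flip_mult)
  moreover have "flip_vertex w \<in> verts X \<longleftrightarrow> w \<in> verts X"
    "flip_vertex w \<in> Unprimed ` A \<longleftrightarrow> w \<in> Primed ` A" for w :: "'a vertex"
    by (cases w; auto)+
  moreover have "flip_vertex u = flip_vertex v \<longleftrightarrow> u = v"
    by (metis flip_vertex_invol)
  ultimately show ?thesis
    using f by (simp add: linked_flip linked_cut_mult del: Un_iff)
qed

lemma one_mult [simp]: "f \<in> partitions X \<Longrightarrow> unity \<bullet> f = f"
  by (rule partitions_eqI[where X = X]) (auto simp: linked_cut_mult intro: linked_refl)

lemma mult_one [simp]: "f \<in> partitions X \<Longrightarrow> f \<bullet> unity = f"
  by (rule partitions_eqI[where X = X]) (auto simp: linked_mult_cut intro: linked_refl)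

lemma cut_mult_iff:
  assumes f: "f \<in> partitions X" and x: "x \<in> X"
  shows "cut X {x} \<bullet> f = f \<longleftrightarrow> upper_singleton X f x"
proof
  assume "cut X {x} \<bullet> f = f"
  then show "upper_singleton X f x"
    using upper_singleton_mult[OF cut_in f, where x = x] x by (metis singletonI upper_singleton_cut)
next
  assume s: "upper_singleton X f x"
  show "cut X {x} \<bullet> f = f"
  proof (rule partitions_eqI[where X = X])
    fix u v assume uv: "u \<in> verts X" "v \<in> verts X"
    have "u = v" if "linked f u v" "u = Unprimed x \<or> v = Unprimed x"
      using that s linked_sym[OF f that(1)] by (auto simp: upper_singleton_def)
    then show "linked (cut X {x} \<bullet> f) u v \<longleftrightarrow> linked f u v"
      using uv linked_refl[OF f uv(1)] by (auto simp: linked_cut_mult[OF f] simp del: Un_iff)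
  qed (use f in simp_all)
qed

lemma cut_Un: "cut X A \<bullet> cut X B = cut X (A \<union> B)"
  by (rule partitions_eqI[where X = X]) (auto simp: linked_cut_mult linked_cut)

text \<open>Each vertex is linked to the upper vertex over the same point, so every link reduces to
  one between upper vertices, where only the trivial ones exist.\<close>

lemma eq_oneI:
  assumes g: "g \<in> partitions X"
    and through: "\<And>x. x \<in> X \<Longrightarrow> linked g (Unprimed x) (Primed x)"
    and sep: "\<And>x y. linked g (Unprimed x) (Unprimed y) \<Longrightarrow> x = y"
  shows "g = unity"
proof (rule partitions_eqI[where X = X])
  fix u v assume uv: "u \<in> verts X" "v \<in> verts X"
  have b: "linked g w (Unprimed (base w))" "base w \<in> X" if "w \<in> verts X" for w
    using that linked_sym[OF g through] linked_refl[OF g] by auto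
  have "linked g u v \<longleftrightarrow> linked g (Unprimed (base u)) (Unprimed (base v))"
    using b[OF uv(1)] b[OF uv(2)] linked_sym[OF g] linked_trans[OF g] by metis
  also have "\<dots> \<longleftrightarrow> base u = base v"
    using sep linked_refl[OF g] b(2)[OF uv(1)] by auto
  finally show "linked g u v \<longleftrightarrow> linked unity u v"
    using uv by (auto simp: linked_cut simp del: Un_iff)
qed (use g in simp_all)

text \<open>If neither case occurs, every upper x is linked to some y', and y to some z'.
  Idempotency links x to z', hence x to y, so x = y. Thus every x is linked to x', and
  \<open>eq_oneI\<close> gives the identity.\<close>

lemma idempotent_cases:
  assumes g: "g \<in> partitions X" and idem: "g \<bullet> g = g" and "g \<noteq> unity"
  obtains x where "upper_singleton X g x"
  | x y where "x \<in> X" "y \<in> X" "x \<noteq> y" "linked g (Unprimed x) (Unprimed y)"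
proof -
  have False if ns: "\<And>x. \<not> upper_singleton X g x"
    and sep: "\<And>x y. linked g (Unprimed x) (Unprimed y) \<Longrightarrow> x = y"
  proof -
    have ex: "\<exists>y. linked g (Unprimed x) (Primed y)" if "x \<in> X" for x
    proof -
      obtain v where v: "linked g (Unprimed x) v" "v \<noteq> Unprimed x"
        using ns[of x] \<open>x \<in> X\<close> by (auto simp: upper_singleton_def)
      then show ?thesis
        using sep linked_in[OF g v(1)] by auto
    qed
    have "x = y" if xy: "linked g (Unprimed x) (Primed y)" for x y
    proof -
      have "y \<in> X" using linked_in[OF g xy] by auto
      then obtain z where z: "linked g (Unprimed y) (Primed z)" using ex by blast
      have "linked g (Unprimed x) (Primed z)"
        using linked_mult_through[OF g g xy z] idem by simp
      then show ?thesis
        using sep linked_trans[OF g _ linked_sym[OF g z]] by blast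
    qed
    then have "g = unity"
      using eq_oneI[OF g _ sep] ex by metis
    with \<open>g \<noteq> unity\<close> show False by simp
  qed
  moreover have "x \<in> X" "y \<in> X" if "linked g (Unprimed x) (Unprimed y)" for x y
    using linked_in[OF g that] by auto
  ultimately show thesis using that by metis
qed

text \<open>Upper links and upper singletons of \<open>w\<close> would survive in
  \<open>w w = 1\<close>, so there are none. Fixing the cut forces \<open>w\<close> to link y to y'
  for y other than x. The upper x must be linked to some b', and b other than x would produce an
  upper link between x and b.\<close>

lemma involution_fixing_cut:
  assumes w: "w \<in> partitions X" and ww: "w \<bullet> w = unity" and wx: "w \<bullet> cut X {x} = cut X {x}"
    and x: "x \<in> X"
  shows "w = unity"
proof (rule eq_oneI[OF w])
  show sep: "a = b" if "linked w (Unprimed a) (Unprimed b)" for a b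
    using linked_mult_upper[OF w w that] by (auto simp: ww linked_cut)
  have other: "linked w (Unprimed y) (Primed y)" if "y \<in> X" "y \<noteq> x" for y
  proof -
    have "linked (w \<bullet> cut X {x}) (Unprimed y) (Primed y)"
      using that by (simp add: wx linked_cut)
    then show ?thesis by (simp add: linked_mult_cut[OF w])
  qed
  fix y assume y: "y \<in> X"
  show "linked w (Unprimed y) (Primed y)"
  proof (cases "y = x")
    case True
    have "\<not> upper_singleton X w x"
      using upper_singleton_mult[OF w w, of x] by (auto simp: ww)
    then obtain v where v: "linked w (Unprimed x) v" "v \<noteq> Unprimed x"
      using x by (auto simp: upper_singleton_def)
    then obtain b where b: "v = Primed b" "b \<in> X"
      using linked_in[OF w v(1)] sep by auto
    have "b = x"
    proof (rule ccontr)
      assume "b \<noteq> x"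
      with linked_trans[OF w v(1)] linked_sym[OF w other] b have "linked w (Unprimed x) (Unprimed b)"
        by blast
      with sep \<open>b \<noteq> x\<close> show False by blast
    qed
    with v b True show ?thesis by simp
  qed (use other y in blast)
qed

lemma swap_props:
  assumes xy: "x \<in> X" "y \<in> X" "x \<noteq> y"
  shows "swap X x y \<bullet> swap X x y = unity" "swap X x y \<noteq> unity"
proof -
  have tr: "transpose x y a \<in> X" if "a \<in> X" for a
    using that xy by (auto simp: transpose_def)
  let ?m = "map_unprimed (transpose x y)"
  have m: "?m w \<in> verts X" "base (?m (?m w)) = base w" if "w \<in> verts X" for w
    using that tr by auto
  show "swap X x y \<bullet> swap X x y = unity"
  proof (rule partitions_eqI[where X = X])
    fix u v assume uv: "u \<in> verts X" "v \<in> verts X"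
    then show "linked (swap X x y \<bullet> swap X x y) u v \<longleftrightarrow> linked unity u v"
      using m[OF uv(1)] m[OF uv(2)]
      by (auto simp: linked_swap_mult[OF swap_in xy(1,2) uv] linked_swap linked_cut simp del: Un_iff)
  qed simp_all
  have "linked (swap X x y) (Unprimed x) (Primed y)" "\<not> linked unity (Unprimed x) (Primed y)"
    using xy by (simp_all add: linked_swap linked_cut)
  then show "swap X x y \<noteq> unity" by metis
qed

lemma swap_mult:
  assumes f: "f \<in> partitions X" and l: "linked f (Unprimed x) (Unprimed y)"
  shows "swap X x y \<bullet> f = f"
proof (rule partitions_eqI[where X = X])
  have xy: "x \<in> X" "y \<in> X" using linked_in[OF f l] by auto
  fix u v assume uv: "u \<in> verts X" "v \<in> verts X"
  have m: "linked f w (map_unprimed (transpose x y) w)" if "w \<in> verts X" for w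
    using that l linked_sym[OF f l] linked_refl[OF f] by (auto simp: transpose_def)
  show "linked (swap X x y \<bullet> f) u v \<longleftrightarrow> linked f u v"
    unfolding linked_swap_mult[OF f xy uv]
    using m[OF uv(1)] m[OF uv(2)] linked_sym[OF f] linked_trans[OF f] by metis
qed (use f in simp_all)

section \<open>Multiplicative bijections: inverses, relabellings, conjugation by the flip\<close>

lemma mult_bij_in: "mult_bij X \<alpha> \<Longrightarrow> f \<in> partitions X \<Longrightarrow> \<alpha> f \<in> partitions X"
  by (auto simp: mult_bij_def dest: bij_betw_apply)

lemma mult_bij_mult:
  "mult_bij X \<alpha> \<Longrightarrow> f \<in> partitions X \<Longrightarrow> g \<in> partitions X \<Longrightarrow> \<alpha> (f \<bullet> g) = \<alpha> f \<bullet> \<alpha> g"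
  by (simp add: mult_bij_def)

lemma mult_bij_comp: "mult_bij X \<alpha> \<Longrightarrow> mult_bij X \<beta> \<Longrightarrow> mult_bij X (\<beta> \<circ> \<alpha>)"
  using mult_bij_in[of \<alpha>] by (auto simp: mult_bij_def intro: bij_betw_trans)

lemma mult_bij_inverse:
  assumes "mult_bij X \<alpha>"
  obtains \<delta> where "mult_bij X \<delta>" "\<And>f. f \<in> partitions X \<Longrightarrow> \<delta> (\<alpha> f) = f"
    "\<And>f. f \<in> partitions X \<Longrightarrow> \<alpha> (\<delta> f) = f"
proof
  let ?\<delta> = "inv_into (partitions X) \<alpha>"
  have b: "bij_betw \<alpha> (partitions X) (partitions X)" using assms by (simp add: mult_bij_def)
  show l: "?\<delta> (\<alpha> f) = f" and r: "\<alpha> (?\<delta> f) = f" if "f \<in> partitions X" for f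
    using b that by (auto simp: bij_betw_def f_inv_into_f)
  have b': "bij_betw ?\<delta> (partitions X) (partitions X)" by (rule bij_betw_inv_into[OF b])
  have "?\<delta> (f \<bullet> g) = ?\<delta> f \<bullet> ?\<delta> g" if "f \<in> partitions X" "g \<in> partitions X" for f g
  proof -
    have "?\<delta> f \<in> partitions X" "?\<delta> g \<in> partitions X" using b' that by (auto dest: bij_betw_apply)
    then show ?thesis
      using l[of "?\<delta> f \<bullet> ?\<delta> g"] r that mult_bij_mult[OF assms] by simp
  qed
  then show "mult_bij X ?\<delta>" using b' by (simp add: mult_bij_def)
qed

lemma mult_bij_relabel:
  assumes "bij_betw s X X"
  shows "mult_bij X (relabel s)"
  unfolding mult_bij_def
proof (intro conjI ballI)
  show "bij_betw (relabel s) (partitions X) (partitions X)"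
    by (rule bij_betw_byWitness[where f' = "relabel (inv_into X s)"])
      (use assms in \<open>auto simp: relabel_inv bij_betw_inv_into\<close>)
qed (use assms in \<open>simp add: relabel_mult\<close>)

lemma mult_bij_flip:
  assumes "mult_bij X \<alpha>"
  shows "mult_bij X (\<lambda>f. flip (\<alpha> (flip f)))"
proof -
  have "bij_betw flip (partitions X) (partitions X)"
    by (rule bij_betw_byWitness[where f' = flip]) auto
  then have "bij_betw (flip \<circ> (\<alpha> \<circ> flip)) (partitions X) (partitions X)"
    using assms by (auto simp: mult_bij_def intro: bij_betw_trans)
  then show ?thesis
    using assms by (simp add: mult_bij_def comp_def flip_mult mult_bij_in[OF assms])
qed

lemma mult_bij_one:
  assumes "mult_bij X \<alpha>"
  shows "\<alpha> unity = unity"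
proof -
  obtain \<delta> where \<delta>: "mult_bij X \<delta>" "\<And>f. f \<in> partitions X \<Longrightarrow> \<alpha> (\<delta> f) = f"
    using mult_bij_inverse[OF assms] by metis
  have "\<alpha> (unity \<bullet> \<delta> unity) = \<alpha> unity \<bullet> \<alpha> (\<delta> unity)"
    using assms mult_bij_in[OF \<delta>(1)] by (intro mult_bij_mult) auto
  then show ?thesis
    using mult_bij_in[OF \<delta>(1)] mult_bij_in[OF assms] by (simp add: \<delta>(2))
qed

section \<open>Images of the point cuts\<close>

lemma cut_idem [simp]: "cut X {x} \<bullet> cut X {x} = cut X {x}"
  by (simp add: cut_Un)

lemma cut_neq_one: "x \<in> X \<Longrightarrow> cut X {x} \<noteq> unity"
  using upper_singleton_cut[of X "{x}" x] upper_singleton_cut[of X "{}" x] by force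

text \<open>The two equations say that the image of the cut and \<open>cut X {y}\<close> generate
  the same right ideal. This is the most that left-hand information can give.\<close>

lemma mult_bij_cut:
  assumes \<alpha>: "mult_bij X \<alpha>" and x: "x \<in> X"
  shows "\<exists>y\<in>X. cut X {y} \<bullet> \<alpha> (cut X {x}) = \<alpha> (cut X {x}) \<and>
    \<alpha> (cut X {x}) \<bullet> cut X {y} = cut X {y}"
proof -
  obtain \<delta> where \<delta>: "mult_bij X \<delta>"
    and \<delta>\<alpha>: "\<And>f. f \<in> partitions X \<Longrightarrow> \<delta> (\<alpha> f) = f"
    and \<alpha>\<delta>: "\<And>f. f \<in> partitions X \<Longrightarrow> \<alpha> (\<delta> f) = f"
    using mult_bij_inverse[OF \<alpha>] by metis
  note [simp] = mult_bij_in[OF \<alpha>] mult_bij_in[OF \<delta>] \<delta>\<alpha> \<alpha>\<delta>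
  define e where "e = \<alpha> (cut X {x})"
  have e: "e \<in> partitions X" and \<delta>e: "\<delta> e = cut X {x}" by (simp_all add: e_def)
  have "e \<bullet> e = e"
    using mult_bij_mult[OF \<alpha>, of "cut X {x}" "cut X {x}"] by (simp add: e_def)
  moreover have "e \<noteq> unity"
    using mult_bij_one[OF \<delta>] \<delta>e cut_neq_one[OF x] by auto
  ultimately consider y where "upper_singleton X e y"
    | z w where "z \<in> X" "w \<in> X" "z \<noteq> w" "linked e (Unprimed z) (Unprimed w)"
    using idempotent_cases[OF e] by metis
  then show ?thesis
  proof cases
    case 1
    then have y: "y \<in> X" by (simp add: upper_singleton_def)
    have ye: "cut X {y} \<bullet> e = e" using 1 e y by (simp add: cut_mult_iff)
    \<comment> \<open>The second equation is obtained by pulling the cut at y back. The product of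
      \<open>d\<close> with the cut at x is that cut, so any upper singleton of \<open>d\<close>
      must be x and \<open>d\<close> has no proper upper link; as an idempotent other than 1 it
      therefore isolates x.\<close>
    define d where "d = \<delta> (cut X {y})"
    have d: "d \<in> partitions X" and \<alpha>d: "\<alpha> d = cut X {y}" by (simp_all add: d_def)
    have dx: "d \<bullet> cut X {x} = cut X {x}"
      using mult_bij_mult[OF \<delta>, of "cut X {y}" e] e ye by (simp add: d_def \<delta>e)
    have "d \<bullet> d = d"
      using mult_bij_mult[OF \<delta>, of "cut X {y}" "cut X {y}"] by (simp add: d_def)
    moreover have "d \<noteq> unity"
      using mult_bij_one[OF \<alpha>] \<alpha>d cut_neq_one[OF y] by auto
    ultimately consider z where "upper_singleton X d z"
      | z w where "z \<in> X" "w \<in> X" "z \<noteq> w" "linked d (Unprimed z) (Unprimed w)"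
      using idempotent_cases[OF d] by metis
    then have "upper_singleton X d x"
    proof cases
      case 1
      then show ?thesis
        using upper_singleton_mult[OF d cut_in 1, of "{x}"] by (simp add: dx)
    next
      case 2
      then show ?thesis
        using linked_mult_upper[OF d cut_in 2(4), of "{x}"] by (simp add: dx linked_cut)
    qed
    then have "cut X {x} \<bullet> d = d" using d x by (simp add: cut_mult_iff)
    then have "e \<bullet> cut X {y} = cut X {y}"
      using mult_bij_mult[OF \<alpha>, of "cut X {x}" d] d by (simp add: e_def \<alpha>d)
    then show ?thesis using y ye unfolding e_def by blast
  next
    case 2
    \<comment> \<open>Impossible case: the swap fixes \<open>e\<close>, so its preimage is an
      involution fixing the cut at x and equals 1, whereas the swap does not.\<close>
    define s where "s = \<delta> (swap X z w)"
    note sw = swap_props[OF 2(1-3)]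
    have "s \<bullet> s = unity"
      using mult_bij_mult[OF \<delta>, of "swap X z w" "swap X z w"] sw(1) mult_bij_one[OF \<delta>]
      by (simp add: s_def)
    moreover have "s \<bullet> cut X {x} = cut X {x}"
      using mult_bij_mult[OF \<delta>, of "swap X z w" e] e swap_mult[OF e 2(4)] by (simp add: s_def \<delta>e)
    ultimately have "s = unity"
      using involution_fixing_cut[of s x] x by (simp add: s_def)
    then have "swap X z w = unity"
      using mult_bij_one[OF \<alpha>] by (metis \<alpha>\<delta> s_def swap_in)
    then show ?thesis using sw(2) by simp
  qed
qed

text \<open>The preimage of the cut at y isolates x', and multiplied by the cut at x it gives that
  cut. Upper singletons survive multiplication, and x is the only one of the result.\<close>

lemma mult_bij_cut_inj:
  assumes \<alpha>: "mult_bij X \<alpha>" and x: "x \<in> X" "x' \<in> X" and y: "y \<in> X"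
    and xy: "cut X {y} \<bullet> \<alpha> (cut X {x}) = \<alpha> (cut X {x})"
    and yx': "\<alpha> (cut X {x'}) \<bullet> cut X {y} = cut X {y}"
  shows "x = x'"
proof -
  obtain \<delta> where \<delta>: "mult_bij X \<delta>"
    and \<delta>\<alpha>: "\<And>f. f \<in> partitions X \<Longrightarrow> \<delta> (\<alpha> f) = f"
    using mult_bij_inverse[OF \<alpha>] by metis
  note [simp] = mult_bij_in[OF \<alpha>] mult_bij_in[OF \<delta>] \<delta>\<alpha>
  let ?d = "\<delta> (cut X {y})"
  have "?d \<bullet> cut X {x} = cut X {x}"
    using mult_bij_mult[OF \<delta>, of "cut X {y}" "\<alpha> (cut X {x})"] xy by simp
  moreover have "cut X {x'} \<bullet> ?d = ?d"
    using mult_bij_mult[OF \<delta>, of "\<alpha> (cut X {x'})" "cut X {y}"] yx' by simp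
  then have "upper_singleton X ?d x'"
    using x by (simp add: cut_mult_iff)
  ultimately show ?thesis
    using upper_singleton_mult[of ?d X "cut X {x}" x'] by simp
qed

text \<open>The conjugate of \<open>\<beta>\<close> by the flip shows that the image of the cut
  absorbs some cut at y on its right. If y were not x, the hypothesis would make the image link y to
  y', although absorbing the cut isolates y'. With y = x the two equations for the same product give
  equality.\<close>

lemma mult_bij_fixes_cut:
  assumes \<beta>: "mult_bij X \<beta>" and x: "x \<in> X"
    and "\<beta> (cut X {x}) \<bullet> cut X {x} = cut X {x}"
  shows "\<beta> (cut X {x}) = cut X {x}"
proof -
  let ?f = "\<beta> (cut X {x})"
  have f: "?f \<in> partitions X" by (simp add: mult_bij_in[OF \<beta>])
  obtain y where y: "y \<in> X" and "cut X {y} \<bullet> flip ?f = flip ?f"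
    using mult_bij_cut[OF mult_bij_flip[OF \<beta>] x] by auto
  then have "flip (cut X {y} \<bullet> flip ?f) = ?f" by simp
  then have fy: "?f \<bullet> cut X {y} = ?f" by (simp add: flip_mult f)
  have "y = x"
  proof (rule ccontr)
    assume "y \<noteq> x"
    then have "linked (?f \<bullet> cut X {x}) (Unprimed y) (Primed y)"
      using y assms(3) by (simp add: linked_cut)
    then have "linked (?f \<bullet> cut X {y}) (Unprimed y) (Primed y)"
      using fy by (simp add: linked_mult_cut[OF f])
    then show False by (simp add: linked_mult_cut[OF f])
  qed
  then show ?thesis using fy assms(3) by simp
qed

section \<open>Images of the ties\<close>

lemma mult_tie_iff:
  assumes f: "f \<in> partitions X" and xy: "x \<in> X" "y \<in> X"
  shows "f \<bullet> tie X x y = f \<longleftrightarrow> linked f (Primed x) (Primed y)"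
proof -
  have "f \<bullet> tie X x y = f \<longleftrightarrow> flip (f \<bullet> tie X x y) = flip f" by (metis flip_flip)
  then show ?thesis
    using tie_mult_iff[OF flip_in[OF f] xy] f by (simp add: flip_mult linked_flip)
qed

lemma tie_neq_unity:
  assumes "x \<in> X" "y \<in> X" "x \<noteq> y"
  shows "tie X x y \<noteq> cut X {}"
proof -
  have "linked (tie X x y) (Unprimed x) (Unprimed y)" "\<not> linked (cut X {}) (Unprimed x) (Unprimed y)"
    using assms by (simp_all add: linked_tie linked_cut)
  then show ?thesis by metis
qed

text \<open>The image is an idempotent other than 1. An upper singleton in it would be detected by a
  fixed cut and so occur in the tie, which has none. Hence it has a proper upper link, and what
  remains is to show that this link involves x and y only.\<close>

lemma linked_mult_bij_tie:
  assumes \<beta>: "mult_bij X \<beta>" and cuts: "\<And>z. z \<in> X \<Longrightarrow> \<beta> (cut X {z}) = cut X {z}"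
    and xy: "x \<in> X" "y \<in> X" "x \<noteq> y"
  shows "linked (\<beta> (tie X x y)) (Unprimed x) (Unprimed y)"
proof -
  obtain \<delta> where \<delta>: "mult_bij X \<delta>"
    and \<delta>\<beta>: "\<And>f. f \<in> partitions X \<Longrightarrow> \<delta> (\<beta> f) = f"
    using mult_bij_inverse[OF \<beta>] by metis
  let ?t = "tie X x y"
  define g where "g = \<beta> ?t"
  have g: "g \<in> partitions X" by (simp add: g_def mult_bij_in[OF \<beta>])
  have txy: "linked ?t (Unprimed x) (Unprimed y)" using xy by (simp add: linked_tie)
  then have "?t \<bullet> ?t = ?t" using tie_mult_iff[OF tie_in xy(1,2)] by blast
  then have "g \<bullet> g = g" using mult_bij_mult[OF \<beta>, of ?t ?t] by (simp add: g_def)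
  moreover have "g \<noteq> cut X {}"
    using \<delta>\<beta>[of ?t] mult_bij_one[OF \<delta>] tie_neq_unity[OF xy] by (auto simp: g_def)
  ultimately consider z where "upper_singleton X g z"
    | z w where "z \<in> X" "w \<in> X" "z \<noteq> w" "linked g (Unprimed z) (Unprimed w)"
    using idempotent_cases[OF g] by metis
  then show ?thesis
  proof cases
    case 1
    then have z: "z \<in> X" by (simp add: upper_singleton_def)
    have "cut X {z} \<bullet> g = g" using 1 by (simp add: cut_mult_iff g z)
    then have "cut X {z} \<bullet> ?t = ?t"
      using mult_bij_mult[OF \<delta>, of "cut X {z}" g] g \<delta>\<beta>[of "cut X {z}"] cuts[OF z] \<delta>\<beta>[of ?t]
      by (simp add: g_def)
    then have "upper_singleton X ?t z" by (simp add: cut_mult_iff z)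
    then show ?thesis by simp
  next
    case 2
    have sub: "v \<in> {x, y}" if v: "v \<in> X" and vv: "linked g (Unprimed v) (Unprimed v')" "v \<noteq> v'" for v v'
    proof (rule ccontr)
      assume nv: "v \<notin> {x, y}"
      \<comment> \<open>\<open>?f\<close> is fixed on the left both by the tie and by the cut at v.
        Its image therefore inherits the link from v to v' out of \<open>g\<close> and at the same
        time isolates v.\<close>
      let ?f = "cut X {v} \<bullet> ?t"
      have f: "?f \<in> partitions X" by simp
      have "linked ?f (Unprimed x) (Unprimed y)"
        using txy nv xy by (auto simp: linked_cut_mult)
      then have "?t \<bullet> ?f = ?f" using tie_mult_iff[OF f xy(1,2)] by blast
      then have "g \<bullet> \<beta> ?f = \<beta> ?f" using mult_bij_mult[OF \<beta> tie_in f, of x y] by (simp add: g_def)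
      then have "linked (\<beta> ?f) (Unprimed v) (Unprimed v')"
        using linked_mult_upper[OF g mult_bij_in[OF \<beta> f] vv(1)] by simp
      moreover have "upper_singleton X ?f v"
        using v upper_singleton_mult[of "cut X {v}" X ?t v] by simp
      then have "cut X {v} \<bullet> ?f = ?f" by (simp add: cut_mult_iff[OF f v])
      then have "cut X {v} \<bullet> \<beta> ?f = \<beta> ?f"
        using mult_bij_mult[OF \<beta> cut_in f, of "{v}"] cuts[OF v] by simp
      then have "upper_singleton X (\<beta> ?f) v"
        by (simp add: cut_mult_iff[OF mult_bij_in[OF \<beta> f] v])
      ultimately show False using vv(2) by (auto simp: upper_singleton_def)
    qed
    have "z \<in> {x, y}" "w \<in> {x, y}"
      using sub[OF 2(1,4,3)] sub[OF 2(2) linked_sym[OF g 2(4)]] 2(3) by auto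
    then show ?thesis
      using 2(3,4) linked_sym[OF g 2(4)] unfolding g_def by auto
  qed
qed

text \<open>The preceding lemma is used twice, for the inverse map and for the conjugate by the
  flip. The inverse yields that the image times the tie is the tie; the conjugate yields a lower
  link, so the same product is also the image.\<close>

lemma mult_bij_fixes_tie:
  assumes \<beta>: "mult_bij X \<beta>" and cuts: "\<And>z. z \<in> X \<Longrightarrow> \<beta> (cut X {z}) = cut X {z}"
    and xy: "x \<in> X" "y \<in> X" "x \<noteq> y"
  shows "\<beta> (tie X x y) = tie X x y"
proof -
  obtain \<delta> where \<delta>: "mult_bij X \<delta>"
    and \<delta>\<beta>: "\<And>f. f \<in> partitions X \<Longrightarrow> \<delta> (\<beta> f) = f"
    and \<beta>\<delta>: "\<And>f. f \<in> partitions X \<Longrightarrow> \<beta> (\<delta> f) = f"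
    using mult_bij_inverse[OF \<beta>] by metis
  let ?t = "tie X x y"
  have \<delta>t: "\<delta> ?t \<in> partitions X" and \<beta>t: "\<beta> ?t \<in> partitions X"
    by (simp_all add: mult_bij_in[OF \<delta>] mult_bij_in[OF \<beta>])
  have "\<delta> (cut X {z}) = cut X {z}" if "z \<in> X" for z
    using \<delta>\<beta>[of "cut X {z}"] cuts[OF that] by simp
  from linked_mult_bij_tie[OF \<delta> this xy] have "?t \<bullet> \<delta> ?t = \<delta> ?t"
    by (simp add: tie_mult_iff[OF \<delta>t xy(1,2)])
  then have "\<beta> ?t \<bullet> ?t = ?t"
    using mult_bij_mult[OF \<beta> tie_in \<delta>t, of x y] by (simp add: \<beta>\<delta>)
  moreover have "linked (flip (\<beta> (flip ?t))) (Unprimed x) (Unprimed y)"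
    by (rule linked_mult_bij_tie[OF mult_bij_flip[OF \<beta>] _ xy]) (simp add: cuts)
  then have "\<beta> ?t \<bullet> ?t = \<beta> ?t"
    by (simp add: mult_tie_iff[OF \<beta>t xy(1,2)] linked_flip)
  ultimately show ?thesis by simp
qed

section \<open>Recovering a partition from its products with cuts and ties\<close>

lemma mult_bij_fixes_cuts:
  assumes \<beta>: "mult_bij X \<beta>" and cuts: "\<And>z. z \<in> X \<Longrightarrow> \<beta> (cut X {z}) = cut X {z}"
    and "finite A" "A \<subseteq> X"
  shows "\<beta> (cut X A) = cut X A"
  using assms(3,4)
proof (induction A rule: finite_induct)
  case empty
  show ?case by (rule mult_bij_one[OF \<beta>])
next
  case (insert a A)
  have "cut X (insert a A) = cut X {a} \<bullet> cut X A" by (simp add: cut_Un)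
  then show ?case using insert mult_bij_mult[OF \<beta>, of "cut X {a}" "cut X A"] cuts[of a] by simp
qed

text \<open>The two cuts isolate every vertex except \<open>Unprimed a\<close> and
  \<open>Primed b\<close>, so the product is the partition into singletons unless \<open>f\<close>
  links these two.\<close>

lemma cut_cut_mult_eq_iff:
  assumes f: "f \<in> partitions X" and ab: "a \<in> X" "b \<in> X"
  shows "cut X (X - {a}) \<bullet> (f \<bullet> cut X (X - {b})) = cut X X \<longleftrightarrow> \<not> linked f (Unprimed a) (Primed b)"
proof
  let ?h = "cut X (X - {a}) \<bullet> (f \<bullet> cut X (X - {b}))"
  have l: "linked ?h u v \<longleftrightarrow> u \<in> verts X \<and> v \<in> verts X \<and> (u = v \<or>
    linked (f \<bullet> cut X (X - {b})) u v \<and> u \<notin> Unprimed ` (X - {a}) \<and> v \<notin> Unprimed ` (X - {a}))" for u v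
    by (rule linked_cut_mult) (simp add: f)
  show "\<not> linked f (Unprimed a) (Primed b)" if "?h = cut X X"
  proof
    assume "linked f (Unprimed a) (Primed b)"
    then have "linked ?h (Unprimed a) (Primed b)"
      using ab by (auto simp: l linked_mult_cut[OF f])
    then show False using that by (simp add: linked_cut ab)
  qed
  show "?h = cut X X" if n: "\<not> linked f (Unprimed a) (Primed b)"
  proof (rule partitions_eqI[where X = X])
    fix u v assume uv: "u \<in> verts X" "v \<in> verts X"
    have "u = v" if "linked ?h u v"
    proof (rule ccontr)
      assume ne: "u \<noteq> v"
      with that have *: "linked f u v" "u \<notin> Unprimed ` (X - {a})" "v \<notin> Unprimed ` (X - {a})"
        "u \<notin> Primed ` (X - {b})" "v \<notin> Primed ` (X - {b})"
        by (auto simp only: l linked_mult_cut[OF f])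
      have "w = Unprimed a \<or> w = Primed b"
        if "w \<in> verts X" "w \<notin> Unprimed ` (X - {a})" "w \<notin> Primed ` (X - {b})" for w
        using that by auto
      then have "u = Unprimed a \<or> u = Primed b" "v = Unprimed a \<or> v = Primed b"
        using uv * by blast+
      with ne n * linked_sym[OF f *(1)] show False by auto
    qed
    then show "linked ?h u v \<longleftrightarrow> linked (cut X X) u v"
      using uv l by (auto simp: linked_cut)
  qed (use f in simp_all)
qed

text \<open>An implication is enough, since the inverse of \<open>\<beta>\<close> fixes the point
  cuts too and gives the converse.\<close>

lemma linked_mult_bij_mono:
  assumes fin: "finite X"
    and \<beta>: "mult_bij X \<beta>" and cuts: "\<And>z. z \<in> X \<Longrightarrow> \<beta> (cut X {z}) = cut X {z}"
    and f: "f \<in> partitions X" and l: "linked f u v"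
  shows "linked (\<beta> f) u v"
proof -
  have \<beta>f: "\<beta> f \<in> partitions X" by (rule mult_bij_in[OF \<beta> f])
  note tie_fix = mult_bij_fixes_tie[OF \<beta> cuts]
  have cut_fix: "\<beta> (cut X A) = cut X A" if "A \<subseteq> X" for A
    by (rule mult_bij_fixes_cuts[OF \<beta> cuts finite_subset[OF that fin] that])
  have up: "linked (\<beta> f) (Unprimed a) (Primed b)" if "linked f (Unprimed a) (Primed b)" for a b
  proof -
    have ab: "a \<in> X" "b \<in> X" using linked_in[OF f that] by auto
    let ?A = "cut X (X - {a})" and ?B = "cut X (X - {b})"
    \<comment> \<open>The test for a link across the halves is an inequation, so
      \<open>\<beta>\<close> transports it by injectivity.\<close>
    have "?A \<bullet> (f \<bullet> ?B) \<noteq> cut X X" using that by (simp add: cut_cut_mult_eq_iff[OF f ab])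
    moreover have "inj_on \<beta> (partitions X)" using \<beta> by (simp add: mult_bij_def bij_betw_def)
    ultimately have "\<beta> (?A \<bullet> (f \<bullet> ?B)) \<noteq> \<beta> (cut X X)"
      using f by (simp add: inj_on_eq_iff)
    moreover have "\<beta> (?A \<bullet> (f \<bullet> ?B)) = ?A \<bullet> (\<beta> f \<bullet> ?B)"
      using f by (simp add: mult_bij_mult[OF \<beta>] cut_fix)
    ultimately show ?thesis
      using cut_cut_mult_eq_iff[OF \<beta>f ab] cut_fix[of X] by simp
  qed
  have "u \<in> verts X" "v \<in> verts X" using linked_in[OF f l] .
  then consider a b where "u = Unprimed a" "v = Unprimed b" "a \<in> X" "b \<in> X"
    | a b where "u = Primed a" "v = Primed b" "a \<in> X" "b \<in> X"
    | a b where "u = Unprimed a" "v = Primed b"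
    | a b where "u = Primed a" "v = Unprimed b" by auto
  then show ?thesis
  proof cases
    case 1
    show ?thesis
    proof (cases "a = b")
      case False
      have "tie X a b \<bullet> f = f" using l 1 by (simp add: tie_mult_iff[OF f])
      then have "tie X a b \<bullet> \<beta> f = \<beta> f"
        using mult_bij_mult[OF \<beta> tie_in f, of a b] tie_fix[OF _ 1(3,4) False] by simp
      then show ?thesis using 1 by (simp add: tie_mult_iff[OF \<beta>f])
    qed (use 1 linked_refl[OF \<beta>f] in auto)
  next
    case 2
    show ?thesis
    proof (cases "a = b")
      case False
      have "f \<bullet> tie X a b = f" using l 2 by (simp add: mult_tie_iff[OF f])
      then have "\<beta> f \<bullet> tie X a b = \<beta> f"
        using mult_bij_mult[OF \<beta> f tie_in, of a b] tie_fix[OF _ 2(3,4) False] by simp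
      then show ?thesis using 2 by (simp add: mult_tie_iff[OF \<beta>f])
    qed (use 2 linked_refl[OF \<beta>f] in auto)
  next
    case 3
    then show ?thesis using up l by simp
  next
    case 4
    then show ?thesis using up linked_sym[OF f l] linked_sym[OF \<beta>f] by simp
  qed
qed

lemma mult_bij_fixing_cuts_is_identity:
  assumes fin: "finite X"
    and \<beta>: "mult_bij X \<beta>" and cuts: "\<And>z. z \<in> X \<Longrightarrow> \<beta> (cut X {z}) = cut X {z}"
    and f: "f \<in> partitions X"
  shows "\<beta> f = f"
proof -
  obtain \<delta> where \<delta>: "mult_bij X \<delta>"
    and \<delta>\<beta>: "\<And>f. f \<in> partitions X \<Longrightarrow> \<delta> (\<beta> f) = f"
    using mult_bij_inverse[OF \<beta>] by metis
  have \<beta>f: "\<beta> f \<in> partitions X" by (rule mult_bij_in[OF \<beta> f])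
  have "\<delta> (cut X {z}) = cut X {z}" if "z \<in> X" for z
    using \<delta>\<beta>[of "cut X {z}"] cuts[OF that] by simp
  note \<delta>_mono = linked_mult_bij_mono[OF fin \<delta> this \<beta>f]
  show ?thesis
  proof (rule partitions_eqI[OF \<beta>f f])
    fix u v
    show "linked (\<beta> f) u v \<longleftrightarrow> linked f u v"
      using \<delta>_mono[of u v] \<delta>\<beta>[OF f] linked_mult_bij_mono[OF fin \<beta> cuts f, of u v] by auto
  qed
qed

text \<open>The map sending x to the point of the cut associated with its image is injective, and by
  finiteness a permutation \<open>s\<close>. After undoing \<open>s\<close>, the equation
  \<open>s(3)\<close> becomes the hypothesis of \<open>mult_bij_fixes_cut\<close>.\<close>

lemma mult_bij_is_relabel:
  assumes fin: "finite X" and \<alpha>: "mult_bij X \<alpha>"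
  obtains s where "bij_betw s X X" "\<And>f. f \<in> partitions X \<Longrightarrow> \<alpha> f = relabel s f"
proof -
  obtain s where s: "\<And>x. x \<in> X \<Longrightarrow> s x \<in> X"
      "\<And>x. x \<in> X \<Longrightarrow> cut X {s x} \<bullet> \<alpha> (cut X {x}) = \<alpha> (cut X {x})"
      "\<And>x. x \<in> X \<Longrightarrow> \<alpha> (cut X {x}) \<bullet> cut X {s x} = cut X {s x}"
    using mult_bij_cut[OF \<alpha>] by metis
  have "inj_on s X"
  proof (rule inj_onI)
    fix x x' assume "x \<in> X" "x' \<in> X" "s x = s x'"
    then show "x = x'" using mult_bij_cut_inj[OF \<alpha>, of x x' "s x"] s by metis
  qed
  then have bij: "bij_betw s X X"
    using endo_inj_surj[OF fin _ \<open>inj_on s X\<close>] s(1) by (auto simp: bij_betw_def)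
  let ?t = "inv_into X s"
  have t: "bij_betw ?t X X" by (rule bij_betw_inv_into[OF bij])
  note \<beta> = mult_bij_comp[OF \<alpha> mult_bij_relabel[OF t]]
  have "relabel ?t (\<alpha> f) = f" if f: "f \<in> partitions X" for f
  proof -
    have "(relabel ?t \<circ> \<alpha>) (cut X {x}) = cut X {x}" if x: "x \<in> X" for x
    proof (rule mult_bij_fixes_cut[OF \<beta> x])
      have "relabel ?t (\<alpha> (cut X {x}) \<bullet> cut X {s x}) = relabel ?t (cut X {s x})"
        by (simp only: s(3)[OF x])
      moreover have "?t (s x) = x" using bij x by (simp add: bij_betw_def)
      ultimately show "(relabel ?t \<circ> \<alpha>) (cut X {x}) \<bullet> cut X {x} = cut X {x}"
        using relabel_mult[OF t mult_bij_in[OF \<alpha> cut_in] cut_in] relabel_cut[OF t s(1)[OF x]] by simp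
    qed
    from mult_bij_fixing_cuts_is_identity[OF fin \<beta> this f] show ?thesis by simp
  qed
  then have "\<alpha> f = relabel s f" if "f \<in> partitions X" for f
    using that relabel_inv(2)[OF mult_bij_in[OF \<alpha> that] bij] by metis
  with bij that show thesis by blast
qed

end

section \<open>The groups of automorphisms and anti-automorphisms\<close>

text \<open>The integer is a sign in the integers modulo 2, ready to be a coordinate of the direct
  product; 1 stands for a flip. The restriction makes the map extensional, as \<open>Bij\<close>
  demands.\<close>

definition signed_relabel :: "'a set \<Rightarrow> int \<Rightarrow> ('a \<Rightarrow> 'a) \<Rightarrow> 'a vertex set set \<Rightarrow> 'a vertex set set" where
  "signed_relabel X i s = (\<lambda>f\<in>partitions X. relabel s (if i = 0 then f else flip f))"

context
  fixes X :: "'a set"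
begin

lemma bij_betw_Bij: "s \<in> Bij X \<Longrightarrow> bij_betw s X X"
  by (simp add: Bij_def)

lemma signed_relabel_Bij:
  assumes "bij_betw s X X"
  shows "signed_relabel X i s \<in> Bij (partitions X)"
proof -
  have "bij_betw (signed_relabel X i s) (partitions X) (partitions X)"
    by (rule bij_betw_byWitness[where f' = "\<lambda>f. if i = 0 then relabel (inv_into X s) f
        else flip (relabel (inv_into X s) f)"])
      (use assms in \<open>auto simp: signed_relabel_def relabel_inv bij_betw_inv_into\<close>)
  then show ?thesis by (simp add: Bij_def signed_relabel_def)
qed

text \<open>Signs add modulo 2 because the flip commutes with relabelling and squares to the
  identity.\<close>

lemma compose_signed_relabel:
  assumes "s \<in> Bij X" "t \<in> Bij X" "i \<in> {0, 1}" "j \<in> {0, 1}"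
  shows "compose (partitions X) (signed_relabel X i s) (signed_relabel X j t) =
    signed_relabel X ((i + j) mod 2) (compose X s t)"
proof (rule ext)
  fix f
  have c: "relabel (compose X s t) g = relabel s (relabel t g)" if "g \<in> partitions X" for g
    using that by (simp add: relabel_relabel compose_def relabel_cong[where s = "\<lambda>x\<in>X. s (t x)" and t = "s \<circ> t"])
  show "compose (partitions X) (signed_relabel X i s) (signed_relabel X j t) f =
    signed_relabel X ((i + j) mod 2) (compose X s t) f"
    using assms(3,4) bij_betw_Bij[OF assms(1)] bij_betw_Bij[OF assms(2)]
    by (auto simp: signed_relabel_def compose_def[of "partitions X"] c relabel_flip)
qed

text \<open>Point cuts are invariant under the flip, so their images reveal the permutation whatever
  the signs are.\<close>

lemma signed_relabel_inj:
  assumes s: "s \<in> Bij X" and t: "t \<in> Bij X"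
    and eq: "signed_relabel X i s = signed_relabel X j t"
  shows "s = t"
proof (rule extensionalityI)
  show "s \<in> extensional X" "t \<in> extensional X" using s t by (simp_all add: Bij_def)
  fix x assume x: "x \<in> X"
  have "cut X {s x} = cut X {t x}"
    using fun_cong[OF eq, of "cut X {x}"] x bij_betw_Bij[OF s] bij_betw_Bij[OF t]
    by (simp add: signed_relabel_def relabel_cut split: if_splits)
  moreover have "s x \<in> X" using x bij_betw_Bij[OF s] bij_betw_apply by metis
  ultimately show "s x = t x"
    using upper_singleton_cut[of X "{s x}" "s x"] upper_singleton_cut[of X "{t x}" "s x"] by simp
qed

lemma signed_relabel_sign:
  assumes s: "s \<in> Bij X" and t: "t \<in> Bij X" and xy: "x \<in> X" "y \<in> X" "x \<noteq> y"
  shows "signed_relabel X 0 s \<noteq> signed_relabel X 1 t"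
proof
  assume eq: "signed_relabel X 0 s = signed_relabel X 1 t"
  then have st: "s = t" by (rule signed_relabel_inj[OF s t])
  \<comment> \<open>A partition that the flip moves once there are two points: all upper vertices
    form one block, all lower ones are singletons.\<close>
  let ?f = "kernel_partition X (\<lambda>u. if u \<in> Unprimed ` X then Unprimed x else u)"
  note inv = relabel_inv(1)[OF _ bij_betw_Bij[OF s]]
  have "relabel s ?f = relabel s (flip ?f)"
    using fun_cong[OF eq, of ?f] by (simp add: signed_relabel_def st)
  then have "relabel (inv_into X s) (relabel s ?f) = relabel (inv_into X s) (relabel s (flip ?f))"
    by (rule arg_cong)
  then have "?f = flip ?f"
    by (simp only: inv[OF kernel_partition_in] inv[OF flip_in[OF kernel_partition_in]])
  moreover have "linked ?f (Unprimed x) (Unprimed y)" "\<not> linked (flip ?f) (Unprimed x) (Unprimed y)"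
    using xy by (auto simp: linked_flip)
  ultimately show False by metis
qed

lemma auto_eq_mult_bij:
  "auto (partition_monoid X) = extensional (partitions X) \<inter> {\<alpha>. mult_bij X \<alpha>}"
  by (auto simp: auto_def hom_def Bij_def mult_bij_def partition_monoid_def dest: bij_betw_apply)

lemma auto_partition_monoid:
  assumes "finite X"
  shows "auto (partition_monoid X) = signed_relabel X 0 ` Bij X"
proof (intro equalityI subsetI)
  fix \<alpha> assume "\<alpha> \<in> auto (partition_monoid X)"
  then have \<alpha>: "\<alpha> \<in> extensional (partitions X)" "mult_bij X \<alpha>"
    by (simp_all add: auto_eq_mult_bij)
  obtain s where s: "bij_betw s X X" "\<And>f. f \<in> partitions X \<Longrightarrow> \<alpha> f = relabel s f"
    using mult_bij_is_relabel[OF assms \<alpha>(2)] by metis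
  have "restrict s X \<in> Bij X"
    using s(1) by (simp add: Bij_def)
  moreover have "\<alpha> = signed_relabel X 0 (restrict s X)"
  proof (rule extensionalityI[OF \<alpha>(1)])
    show "signed_relabel X 0 (restrict s X) \<in> extensional (partitions X)"
      by (simp add: signed_relabel_def)
    show "\<alpha> f = signed_relabel X 0 (restrict s X) f" if "f \<in> partitions X" for f
      using that s(2)[OF that] relabel_cong[OF that, of "restrict s X" s] by (simp add: signed_relabel_def)
  qed
  ultimately show "\<alpha> \<in> signed_relabel X 0 ` Bij X" by blast
next
  fix \<alpha> assume "\<alpha> \<in> signed_relabel X 0 ` Bij X"
  then obtain s where s: "bij_betw s X X" and \<alpha>: "\<alpha> = signed_relabel X 0 s"
    using bij_betw_Bij by auto
  have "\<alpha> \<in> Bij (partitions X)"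
    unfolding \<alpha> by (rule signed_relabel_Bij[OF s])
  then show "\<alpha> \<in> auto (partition_monoid X)"
    using relabel_mult[OF s] unfolding auto_eq_mult_bij \<alpha> Bij_def mult_bij_def
    by (auto simp: signed_relabel_def)
qed

lemma anti_auto_partition_monoid:
  assumes "finite X"
  shows "anti_auto (partition_monoid X) = signed_relabel X 1 ` Bij X"
proof (intro equalityI subsetI)
  fix \<alpha> assume "\<alpha> \<in> anti_auto (partition_monoid X)"
  then have \<alpha>: "\<alpha> \<in> extensional (partitions X)" "bij_betw \<alpha> (partitions X) (partitions X)"
    and anti: "\<And>f g. f \<in> partitions X \<Longrightarrow> g \<in> partitions X \<Longrightarrow>
      \<alpha> (partition_mult X f g) = partition_mult X (\<alpha> g) (\<alpha> f)"
    by (auto simp: anti_auto_def Bij_def partition_monoid_def)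
  have "bij_betw flip (partitions X) (partitions X)"
    by (rule bij_betw_byWitness[where f' = flip]) auto
  then have "bij_betw (\<alpha> \<circ> flip) (partitions X) (partitions X)"
    using \<alpha>(2) by (rule bij_betw_trans)
  then have "mult_bij X (\<alpha> \<circ> flip)"
    by (simp add: mult_bij_def flip_mult anti)
  then obtain s where s: "bij_betw s X X" "\<And>f. f \<in> partitions X \<Longrightarrow> (\<alpha> \<circ> flip) f = relabel s f"
    using mult_bij_is_relabel[OF assms] by metis
  have "restrict s X \<in> Bij X"
    using s(1) by (simp add: Bij_def)
  moreover have "\<alpha> = signed_relabel X 1 (restrict s X)"
  proof (rule extensionalityI[OF \<alpha>(1)])
    show "signed_relabel X 1 (restrict s X) \<in> extensional (partitions X)"
      by (simp add: signed_relabel_def)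
    show "\<alpha> f = signed_relabel X 1 (restrict s X) f" if "f \<in> partitions X" for f
      using that s(2)[OF flip_in[OF that]] relabel_cong[OF flip_in[OF that], of "restrict s X" s]
      by (simp add: signed_relabel_def)
  qed
  ultimately show "\<alpha> \<in> signed_relabel X 1 ` Bij X" by blast
next
  fix \<alpha> assume "\<alpha> \<in> signed_relabel X 1 ` Bij X"
  then obtain s where s: "bij_betw s X X" and \<alpha>: "\<alpha> = signed_relabel X 1 s"
    using bij_betw_Bij by auto
  have "\<alpha> \<in> Bij (partitions X)"
    unfolding \<alpha> by (rule signed_relabel_Bij[OF s])
  then show "\<alpha> \<in> anti_auto (partition_monoid X)"
    using relabel_mult[OF s] unfolding anti_auto_def \<alpha>
    by (auto simp: signed_relabel_def partition_monoid_def flip_mult)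
qed

abbreviation (input) sign_perm_group ("\<G>") where "\<G> \<equiv> integer_mod_group 2 \<times>\<times> BijGroup X"
abbreviation (input) signed_relabel_pair ("\<Phi>") where "\<Phi> \<equiv> \<lambda>(i, s). signed_relabel X i s"

lemma carrier_sign_perm_group: "carrier \<G> = {0, 1} \<times> Bij X"
proof -
  have "{0..<2} = {0, 1 :: int}" by auto
  then show ?thesis by (simp add: carrier_integer_mod_group BijGroup_def)
qed

lemma group_sign_perm_group: "group \<G>"
  by (intro DirProd_group group_integer_mod_group group_BijGroup)

lemma signed_relabel_pair_hom: "\<Phi> \<in> hom \<G> (BijGroup (partitions X))"
proof (rule homI)
  fix p assume "p \<in> carrier \<G>"
  then show "\<Phi> p \<in> carrier (BijGroup (partitions X))"
    by (auto simp: carrier_sign_perm_group BijGroup_def intro: signed_relabel_Bij bij_betw_Bij)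
next
  fix p q assume pq: "p \<in> carrier \<G>" "q \<in> carrier \<G>"
  obtain i s j t where p: "p = (i, s)" and q: "q = (j, t)" by fastforce
  have "i \<in> {0, 1}" "j \<in> {0, 1}" "s \<in> Bij X" "t \<in> Bij X"
    using pq unfolding carrier_sign_perm_group p q by auto
  then show "\<Phi> (p \<otimes>\<^bsub>\<G>\<^esub> q) = \<Phi> p \<otimes>\<^bsub>BijGroup (partitions X)\<^esub> \<Phi> q"
    using signed_relabel_Bij[OF bij_betw_Bij]
    by (simp add: p q mult_DirProd' compose_signed_relabel BijGroup_def)
qed

lemma carrier_AutoPMGroup:
  assumes "finite X"
  shows "carrier (AutoPMGroup (partition_monoid X)) = \<Phi> ` carrier \<G>"
  unfolding carrier_sign_perm_group
  by (auto simp: AutoPMGroup_def auto_partition_monoid anti_auto_partition_monoid assms)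

lemma carrier_partition_monoid: "carrier (partition_monoid X) = partitions X"
  by (simp add: partition_monoid_def)

lemma AutoPMGroup_eq:
  assumes "finite X"
  shows "AutoPMGroup (partition_monoid X) = BijGroup (partitions X) \<lparr>carrier := \<Phi> ` carrier \<G>\<rparr>"
proof -
  have "auto (partition_monoid X) \<union> anti_auto (partition_monoid X) = \<Phi> ` carrier \<G>"
    using carrier_AutoPMGroup[OF assms] by (simp add: AutoPMGroup_def)
  then show ?thesis by (simp add: AutoPMGroup_def carrier_partition_monoid)
qed

text \<open>The carrier is the image of a homomorphism into the symmetric group on
  \<open>partitions X\<close>, so no case distinction by sign is required.\<close>

lemma group_AutoPMGroup:
  assumes "finite X"
  shows "group (AutoPMGroup (partition_monoid X))"
proof -
  interpret group_hom \<G> "BijGroup (partitions X)" \<Phi>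
    by (intro group_hom.intro group_hom_axioms.intro group_sign_perm_group group_BijGroup
        signed_relabel_pair_hom)
  show ?thesis
    unfolding AutoPMGroup_eq[OF assms]
    by (rule subgroup.subgroup_is_group[OF img_is_subgroup group_BijGroup])
qed

lemma AutoGroup_iso:
  assumes "finite X"
  shows "AutoGroup (partition_monoid X) \<cong> BijGroup X"
proof -
  have "signed_relabel X 0 \<in> iso (BijGroup X) (AutoGroup (partition_monoid X))"
  proof (rule isoI)
    show "signed_relabel X 0 \<in> hom (BijGroup X) (AutoGroup (partition_monoid X))"
      using signed_relabel_Bij[OF bij_betw_Bij]
      by (auto simp: hom_def BijGroup_def AutoGroup_def auto_partition_monoid[OF assms]
          carrier_partition_monoid compose_signed_relabel)
    show "bij_betw (signed_relabel X 0) (carrier (BijGroup X)) (carrier (AutoGroup (partition_monoid X)))"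
      by (auto simp: bij_betw_def AutoGroup_def BijGroup_def auto_partition_monoid[OF assms]
          intro: inj_onI signed_relabel_inj)
  qed
  then have "BijGroup X \<cong> AutoGroup (partition_monoid X)" by (rule is_isoI)
  then show ?thesis by (rule group.iso_sym[OF group_BijGroup])
qed

lemma AutoPMGroup_iso:
  assumes "finite X" and xy: "x \<in> X" "y \<in> X" "x \<noteq> y"
  shows "AutoPMGroup (partition_monoid X) \<cong> \<G>"
proof -
  have "\<Phi> \<in> iso \<G> (AutoPMGroup (partition_monoid X))"
  proof (rule isoI)
    show "\<Phi> \<in> hom \<G> (AutoPMGroup (partition_monoid X))"
      using signed_relabel_pair_hom by (auto simp: hom_def AutoPMGroup_eq[OF assms(1)])
    have "inj_on \<Phi> ({0, 1} \<times> Bij X)"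
    proof (rule inj_onI)
      fix p q assume pq: "p \<in> {0, 1} \<times> Bij X" "q \<in> {0, 1} \<times> Bij X" "\<Phi> p = \<Phi> q"
      obtain i s j t where p: "p = (i, s)" and q: "q = (j, t)" by fastforce
      with pq have st: "s \<in> Bij X" "t \<in> Bij X" and i: "i \<in> {0, 1}" "j \<in> {0, 1}"
        and eq: "signed_relabel X i s = signed_relabel X j t" by auto
      have "i = j"
        using i eq signed_relabel_sign[OF st xy] signed_relabel_sign[OF st(2,1) xy] by auto
      with signed_relabel_inj[OF st eq] show "p = q" by (simp add: p q)
    qed
    then show "bij_betw \<Phi> (carrier \<G>) (carrier (AutoPMGroup (partition_monoid X)))"
      by (simp only: bij_betw_def carrier_AutoPMGroup[OF assms(1)] carrier_sign_perm_group simp_thms)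
  qed
  then have "\<G> \<cong> AutoPMGroup (partition_monoid X)" by (rule is_isoI)
  then show ?thesis by (rule group.iso_sym[OF group_sign_perm_group])
qed

section \<open>Generation by involutions\<close>

lemma signed_relabel_id: "signed_relabel X 0 (\<lambda>x\<in>X. x) = (\<lambda>f\<in>partitions X. f)"
  by (auto simp: signed_relabel_def relabel_id intro!: restrict_ext)

lemma mult_AutoPMGroup:
  assumes "i \<in> {0, 1}" "j \<in> {0, 1}" "s \<in> Bij X" "t \<in> Bij X"
  shows "signed_relabel X i s \<otimes>\<^bsub>AutoPMGroup (partition_monoid X)\<^esub> signed_relabel X j t =
    signed_relabel X ((i + j) mod 2) (compose X s t)"
  using assms signed_relabel_Bij[OF bij_betw_Bij]
  by (simp add: AutoPMGroup_def BijGroup_def carrier_partition_monoid compose_signed_relabel)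

lemma signed_relabel_in_involutions:
  assumes "finite X" and xy: "x \<in> X" "y \<in> X" "x \<noteq> y"
    and s: "s \<in> Bij X" "compose X s s = (\<lambda>x\<in>X. x)"
  shows "signed_relabel X 1 s \<in> involutions (partition_monoid X)"
  using s compose_signed_relabel[OF s(1) s(1), of 1 1] signed_relabel_sign[OF id_Bij s(1) xy]
  by (auto simp: involutions_def carrier_partition_monoid anti_auto_partition_monoid[OF assms(1)]
      signed_relabel_id)

text \<open>The flip is an involution, and so is the flip followed by a transposition; their product
  is the automorphism given by the transposition. Transpositions generate all permutations, and one
  more flip supplies the anti-automorphisms.\<close>

lemma involution_subgroup_eq_of_two_points:
  assumes fin: "finite X" and xy: "x \<in> X" "y \<in> X" "x \<noteq> y"
  shows "carrier (AutoPMGroup (partition_monoid X)) \<subseteq> involution_subgroup (partition_monoid X)"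
proof -
  let ?C = "involution_subgroup (partition_monoid X)"
  have mult: "signed_relabel X ((i + j) mod 2) (compose X s t) \<in> ?C"
    if "signed_relabel X i s \<in> ?C" "signed_relabel X j t \<in> ?C"
      "i \<in> {0, 1}" "j \<in> {0, 1}" "s \<in> Bij X" "t \<in> Bij X" for i j s t
    using generate.eng[OF that(1,2)[unfolded involution_subgroup_def]] mult_AutoPMGroup[OF that(3-6)]
    by (simp add: involution_subgroup_def)
  have inv: "signed_relabel X 1 s \<in> ?C" if "s \<in> Bij X" "compose X s s = (\<lambda>x\<in>X. x)" for s
    unfolding involution_subgroup_def
    by (rule generate.incl[OF signed_relabel_in_involutions[OF fin xy that]])
  have flip_in_C: "signed_relabel X 1 (\<lambda>x\<in>X. x) \<in> ?C"
    by (rule inv[OF id_Bij]) (auto simp: compose_def)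
  have comp_id: "compose X s (\<lambda>x\<in>X. x) = s" if "s \<in> Bij X" for s
    using that by (intro compose_Id[of s X X] Bij_imp_funcset Bij_imp_extensional)
  have even: "signed_relabel X 0 (restrict p X) \<in> ?C" if "p permutes X" for p
    using that fin
  proof (induction rule: permutes_induct)
    case id
    have "signed_relabel X 0 (\<lambda>x\<in>X. x) \<in> ?C"
      using mult[OF flip_in_C flip_in_C _ _ id_Bij id_Bij] by simp
    then show ?case by (simp only: id_def)
  next
    case (swap a b p)
    let ?t = "restrict (transpose a b) X"
    have tr: "transpose a b c \<in> X" if "c \<in> X" for c
      using that swap by (auto simp: transpose_def)
    have t: "?t \<in> Bij X"
      using permutes_swap_id[OF swap(1,2)] by (simp add: Bij_def permutes_imp_bij)
    have p: "restrict p X \<in> Bij X"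
      using swap by (simp add: Bij_def permutes_imp_bij)
    have "signed_relabel X 1 ?t \<in> ?C"
      by (rule inv[OF t]) (auto simp: compose_def tr)
    then have "signed_relabel X 0 ?t \<in> ?C"
      using mult[of 1 ?t 1, OF _ flip_in_C _ _ t id_Bij] by (simp add: comp_id[OF t])
    then have "signed_relabel X 0 (compose X ?t (restrict p X)) \<in> ?C"
      using mult[of 0 ?t 0 "restrict p X"] swap p t by simp
    moreover have "compose X ?t (restrict p X) = restrict (transpose a b \<circ> p) X"
      using swap permutes_in_image[of p X] by (auto simp: compose_def)
    ultimately show ?case by (simp only:)
  qed
  have "signed_relabel X i s \<in> ?C" if i: "i \<in> {0, 1}" and s: "s \<in> Bij X" for i s
  proof -
    \<comment> \<open>Elements of \<open>Bij X\<close> are \<open>undefined\<close> off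
      \<open>X\<close>, whereas \<open>permutes\<close> asks for the identity there.\<close>
    let ?p = "\<lambda>x. if x \<in> X then s x else x"
    have "bij_betw ?p X X" using bij_betw_Bij[OF s] by (simp cong: bij_betw_cong)
    then have "?p permutes X" by (rule bij_imp_permutes) simp
    moreover have "restrict ?p X = s"
      using Bij_imp_extensional[OF s] by (auto simp: extensional_def)
    ultimately have "signed_relabel X 0 s \<in> ?C" using even by metis
    moreover from this have "signed_relabel X 1 s \<in> ?C"
      using mult[of 0 s 1, OF _ flip_in_C _ _ s id_Bij] by (simp add: comp_id[OF s])
    ultimately show ?thesis using i by auto
  qed
  then show ?thesis
    unfolding carrier_AutoPMGroup[OF fin] carrier_sign_perm_group by auto
qed

text \<open>Over at most one point the only two vertices are exchanged by the flip, so every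
  partition is symmetric and relabelling changes nothing.\<close>

lemma carrier_AutoPMGroup_trivial:
  assumes fin: "finite X" and triv: "\<And>x y. x \<in> X \<Longrightarrow> y \<in> X \<Longrightarrow> x = y"
  shows "carrier (AutoPMGroup (partition_monoid X)) \<subseteq> {\<one>\<^bsub>AutoPMGroup (partition_monoid X)\<^esub>}"
proof -
  have flip: "flip f = f" if f: "f \<in> partitions X" for f
  proof (rule partitions_eqI[where X = X])
    fix u v assume uv: "u \<in> verts X" "v \<in> verts X"
    show "linked (flip f) u v \<longleftrightarrow> linked f u v"
    proof (cases "u = v")
      case True
      then show ?thesis using linked_refl[OF f uv(1)] linked_refl[OF flip_in[OF f] uv(1)] by simp
    next
      case False
      then have "v = flip_vertex u" using uv triv by auto
      then show ?thesis using linked_sym[OF f] by (auto simp: linked_flip)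
    qed
  qed (use f in simp_all)
  have "signed_relabel X i s = (\<lambda>f\<in>partitions X. f)" if s: "s \<in> Bij X" for i s
  proof -
    have "s x = x" if "x \<in> X" for x
      using that triv bij_betw_apply[OF bij_betw_Bij[OF s] that] by blast
    then have "relabel s (if i = 0 then f else flip f) = f" if "f \<in> partitions X" for f
      using that by (simp add: relabel_id flip)
    then show ?thesis
      unfolding signed_relabel_def by (rule restrict_ext)
  qed
  then show ?thesis
    unfolding carrier_AutoPMGroup[OF fin] carrier_sign_perm_group
    by (auto simp: AutoPMGroup_def BijGroup_def carrier_partition_monoid)
qed

lemma involution_subgroup_eq:
  assumes fin: "finite X"
  shows "involution_subgroup (partition_monoid X) = carrier (AutoPMGroup (partition_monoid X))"
proof
  have "involutions (partition_monoid X) \<subseteq> carrier (AutoPMGroup (partition_monoid X))"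
    by (auto simp: involutions_def AutoPMGroup_def)
  then show "involution_subgroup (partition_monoid X) \<subseteq> carrier (AutoPMGroup (partition_monoid X))"
    unfolding involution_subgroup_def by (rule group.generate_incl[OF group_AutoPMGroup[OF fin]])
  show "carrier (AutoPMGroup (partition_monoid X)) \<subseteq> involution_subgroup (partition_monoid X)"
  proof (cases "\<exists>x\<in>X. \<exists>y\<in>X. x \<noteq> y")
    case True
    then show ?thesis using involution_subgroup_eq_of_two_points[OF fin] by blast
  next
    case False
    then have "carrier (AutoPMGroup (partition_monoid X)) \<subseteq> {\<one>\<^bsub>AutoPMGroup (partition_monoid X)\<^esub>}"
      by (intro carrier_AutoPMGroup_trivial[OF fin]) blast
    then show ?thesis
      using generate.one[of "AutoPMGroup (partition_monoid X)"] by (auto simp: involution_subgroup_def)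
  qed
qed

end

text \<open>The factor of order two appears from two points on: over at most one point the flip is
  the identity, all automorphisms and anti-automorphisms are trivial, and the third isomorphism
  would fail.\<close>

theorem mainTheorem9:
  fixes X :: "'a set"
  assumes "finite X"
  shows "AutoGroup (partition_monoid X) \<cong> BijGroup X \<and>
         involution_subgroup (partition_monoid X) = carrier (AutoPMGroup (partition_monoid X)) \<and>
         (2 \<le> card X \<longrightarrow>
           AutoPMGroup (partition_monoid X) \<cong> integer_mod_group 2 \<times>\<times> BijGroup X)"
proof (intro conjI impI)
  show "AutoGroup (partition_monoid X) \<cong> BijGroup X"
    by (rule AutoGroup_iso[OF assms])
  show "involution_subgroup (partition_monoid X) = carrier (AutoPMGroup (partition_monoid X))"
    by (rule involution_subgroup_eq[OF assms])
  assume "2 \<le> card X"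
  then have "\<not> card X \<le> Suc 0" by simp
  then obtain x y where "x \<in> X" "y \<in> X" "x \<noteq> y"
    using card_le_Suc0_iff_eq[OF assms] by blast
  then show "AutoPMGroup (partition_monoid X) \<cong> integer_mod_group 2 \<times>\<times> BijGroup X"
    by (rule AutoPMGroup_iso[OF assms])
qed

end
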